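(* Let $\varphi$ be the Laplace transform of a strictly positive random variable, let $j\ge0$ and $k\ge1$ be integers, and let $\Theta\subset(0,\infty)$. For each $\theta\in\Theta$ let $X_{\theta,1},X_{\theta,2},\dots$ be i.i.d. real random variables, put $S_{\theta,m}=X_{\theta,1}+\dots+X_{\theta,m}$ for integers $m\ge1$, and let $N_\theta$ be a non-negative integer-valued random variable, independent of $\{X_{\theta,i}\}_{i\ge1}$, with probability generating function $P_\theta(s)=s^j\varphi\{(1-s^k)/\theta\}$, $0<s<1$. Let $\theta_n\in\Theta$ with $\theta_n\downarrow0$ as $n\to\infty$, and let $\{k_n\}$ be a sequence of positive integers such that $S_{\theta_n,k_n}\xrightarrow{d}U$ as $n\to\infty$, where $U$ is infinitely divisible. Then the limit law, as $n\to\infty$, of the $N_\theta$-sums $S_{\theta_n,N_{\theta_n}}=X_{\theta_n,1}+\dots+X_{\theta_n,N_{\theta_n}}$ is necessarily a $\varphi$-mixture of an infinitely divisible law; that is, if $S_{\theta_n,N_{\theta_n}}$ converges in distribution to some law, then the characteristic function of that law is $\varphi\{-\log\omega\}$ for some infinitely divisible characteristic function $\omega$.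
   Context: The Laplace transform of a random variable $Z>0$ is $\varphi(v)=E[e^{-vZ}]$, defined for complex $v$ with $\mathrm{Re}\,v\ge0$. For every $\theta>0$ and integers $j\ge0$, $k\ge1$, the function $s^j\varphi\{(1-s^k)/\theta\}$ is a probability generating function. A characteristic function $\omega$ is infinitely divisible iff $\omega^s$ is a characteristic function for every $s>0$; then $\omega$ has no real zero and $\log\omega$ is its continuous logarithm with $\log\omega(0)=0$. The $\varphi$-mixture of the infinitely divisible law with characteristic function $\omega$ is the law with characteristic function $u\mapsto\varphi(-\log\omega(u))$. An empty sum ($N_\theta=0$) equals $0$. *)

theory Defs
  imports "HOL-Probability.Probability"
begin

text \<open>Only used for \<open>Re v \<ge> 0\<close>, where the integrand is bounded by 1 when \<open>Z > 0\<close> a.s.\<close>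

definition laplace_transform :: "'a measure \<Rightarrow> ('a \<Rightarrow> real) \<Rightarrow> complex \<Rightarrow> complex" where
  "laplace_transform M Z v = (CLINT x|M. exp (- v * complex_of_real (Z x)))"

definition prob_gen_fun :: "'a measure \<Rightarrow> ('a \<Rightarrow> nat) \<Rightarrow> real \<Rightarrow> real" where
  "prob_gen_fun M N s = (LINT x|M. s ^ N x)"

definition char_fun :: "(real \<Rightarrow> complex) \<Rightarrow> bool" where
  "char_fun \<omega> \<longleftrightarrow> (\<exists>M. real_distribution M \<and> char M = \<omega>)"

definition is_cont_log :: "(real \<Rightarrow> complex) \<Rightarrow> (real \<Rightarrow> complex) \<Rightarrow> bool" where
  "is_cont_log \<omega> \<psi> \<longleftrightarrow> continuous_on UNIV \<psi> \<and> \<psi> 0 = 0 \<and> (\<forall>u. exp (\<psi> u) = \<omega> u)"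

text \<open>Well defined for a characteristic function without real zeros; see \<open>is_cont_log_char_log\<close>.\<close>

definition char_log :: "(real \<Rightarrow> complex) \<Rightarrow> real \<Rightarrow> complex" where
  "char_log \<omega> = (THE \<psi>. is_cont_log \<omega> \<psi>)"

text \<open>\<open>\<omega>\<^sup>s\<close> is the power formed with the continuous logarithm, which requires that \<open>\<omega>\<close>
  have no real zero.\<close>

definition inf_div_char_fun :: "(real \<Rightarrow> complex) \<Rightarrow> bool" where
  "inf_div_char_fun \<omega> \<longleftrightarrow>
     char_fun \<omega> \<and> (\<forall>u. \<omega> u \<noteq> 0) \<and>
     (\<forall>s>0. char_fun (\<lambda>u. exp (complex_of_real s * char_log \<omega> u)))"

lemma is_cont_log_unique:
  assumes "is_cont_log \<omega> \<psi>" "is_cont_log \<omega> \<psi>'"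
  shows "\<psi> = \<psi>'"
proof -
  define d where "d = (\<lambda>u. (\<psi> u - \<psi>' u) / (2 * of_real pi * \<i>))"
  have d_int: "d u \<in> \<int>" for u
  proof -
    have "exp (\<psi> u) = exp (\<psi>' u)"
      using assms by (simp add: is_cont_log_def)
    then obtain n :: int where "\<psi> u = \<psi>' u + (of_int (2 * n) * pi) * \<i>"
      by (auto simp: exp_eq)
    then have "d u = of_int n"
      by (simp add: d_def field_simps)
    then show ?thesis by simp
  qed
  have cont: "continuous_on UNIV d"
    using assms unfolding d_def is_cont_log_def by (intro continuous_intros) auto
  have "d constant_on UNIV"
  proof (rule continuous_discrete_range_constant[OF _ cont])
    show "connected (UNIV :: real set)" by simp
    fix x :: real
    have "1 \<le> norm (d y - d x)" if "d y \<noteq> d x" for y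
    proof -
      obtain a b where ab: "d y = of_int a" "d x = of_int b"
        using d_int by (meson Ints_cases)
      then have "1 \<le> \<bar>a - b\<bar>" using that by auto
      then have "1 \<le> \<bar>real_of_int (a - b)\<bar>" by linarith
      moreover have "norm (d y - d x) = \<bar>real_of_int (a - b)\<bar>"
        unfolding ab by (metis norm_of_int of_int_diff)
      ultimately show ?thesis by simp
    qed
    then show "\<exists>e>0. \<forall>y. y \<in> UNIV \<and> d y \<noteq> d x \<longrightarrow> e \<le> norm (d y - d x)"
      by (intro exI[of _ 1]) auto
  qed
  moreover have "d 0 = 0"
    using assms by (simp add: d_def is_cont_log_def)
  ultimately have "d u = 0" for u
    unfolding constant_on_def by (metis UNIV_I)
  then show ?thesis by (auto simp: d_def)
qed

lemma char_log_eqI: "is_cont_log \<omega> \<psi> \<Longrightarrow> char_log \<omega> = \<psi>"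
  unfolding char_log_def using is_cont_log_unique by blast

lemma is_cont_log_char_log:
  assumes "char_fun \<omega>" "\<And>u. \<omega> u \<noteq> 0"
  shows "is_cont_log \<omega> (char_log \<omega>)"
proof -
  obtain M where M: "real_distribution M" "char M = \<omega>"
    using assms(1) by (auto simp: char_fun_def)
  then have cont: "continuous_on UNIV \<omega>" and \<omega>0: "\<omega> 0 = 1"
    using real_distribution.isCont_char[OF M(1)] real_distribution.char_zero[OF M(1)]
    by (auto intro!: continuous_at_imp_continuous_on)
  obtain g where g: "continuous_on UNIV g" "\<And>x. \<omega> x = exp (g x)"
    using continuous_logarithm_on_contractible[OF cont _ assms(2)]
      convex_imp_contractible[OF convex_UNIV] by auto
  have "exp (g 0) = 1" using g(2)[of 0] \<omega>0 by simp
  then have "is_cont_log \<omega> (\<lambda>u. g u - g 0)"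
    using g by (auto simp: is_cont_log_def exp_diff intro!: continuous_intros)
  then show ?thesis using char_log_eqI by metis
qed

lemma inf_div_char_fun_root:
  assumes "inf_div_char_fun \<omega>" "n > 0"
  shows "\<exists>\<omega>'. char_fun \<omega>' \<and> (\<forall>u. \<omega>' u ^ n = \<omega> u)"
proof (intro exI conjI allI)
  show "char_fun (\<lambda>u. exp (complex_of_real (1 / real n) * char_log \<omega> u))"
    using assms(1) \<open>n > 0\<close> zero_less_divide_1_iff[of "real n"] of_nat_0_less_iff[of n]
    unfolding inf_div_char_fun_def by blast
  fix u
  have "exp (char_log \<omega> u) = \<omega> u"
    using assms(1) is_cont_log_char_log unfolding inf_div_char_fun_def is_cont_log_def by blast
  then show "exp (complex_of_real (1 / real n) * char_log \<omega> u) ^ n = \<omega> u"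
    using assms(2) by (simp flip: exp_of_nat_mult)
qed

end

theory Submission
  imports Defs "HOL-Complex_Analysis.Complex_Analysis"
begin

text \<open>Let \<open>f\<^sub>n\<close> be the characteristic function of the summands at \<open>\<theta>\<^sub>n\<close> and
  \<open>g\<^sub>n = (1 - f\<^sub>n ^ k) / \<theta>\<^sub>n\<close>. The random sums have characteristic function
  \<open>f\<^sub>n ^ j * \<phi> (g\<^sub>n)\<close>. Since these converge, they are close to \<open>1\<close> uniformly near \<open>0\<close>, which
  bounds \<open>Re g\<^sub>n\<close> there and forces \<open>f\<^sub>n \<rightarrow> 1\<close>; as \<open>v = 0\<close> is
  an isolated solution of \<open>\<phi> v = 1\<close> in the right half-plane and \<open>g\<^sub>n\<close> is a continuous path starting at
  \<open>0\<close>, the functions \<open>g\<^sub>n\<close> are uniformly small near \<open>0\<close>. The inequality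
  \<open>|g (u + h) - g u - g h| \<le> 2 sqrt (|g u| |g h|)\<close> spreads this to local boundedness and equicontinuity,
  so a subsequence of \<open>g\<^sub>n\<close> converges pointwise to a continuous \<open>G\<close>, and the limit law has characteristic
  function \<open>\<phi> (G)\<close>. Finally \<open>exp (- s G)\<close> is the limit of the characteristic functions
  \<open>f\<^sub>n ^ (k \<lfloor>s / \<theta>\<^sub>n\<rfloor>)\<close> of partial sums, so \<open>exp (- G)\<close> is infinitely divisible.\<close>

section \<open>Laplace transforms of positive random variables\<close>

text \<open>This keeps the arguments \<open>(1 - z ^ k) / t\<close> in the half-plane on which
  \<phi> is defined.\<close>

lemma Re_one_minus_div_nonneg:
  assumes "norm z \<le> 1" "0 < t"
  shows "0 \<le> Re ((1 - z) / complex_of_real t)"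
  using assms complex_Re_le_cmod[of z] by (simp add: Re_divide_of_real)

locale positive_random_variable = prob_space Q for Q :: "'z measure" +
  fixes Z :: "'z \<Rightarrow> real"
  assumes borel_Z [measurable]: "Z \<in> borel_measurable Q"
    and Z_pos: "AE x in Q. 0 < Z x"
begin

lemma AE_norm_exp_le_1:
  assumes "0 \<le> Re v"
  shows "AE x in Q. norm (exp (- v * complex_of_real (Z x))) \<le> 1"
  using Z_pos by eventually_elim (use assms in \<open>simp add: mult_nonneg_nonneg\<close>)

lemma integrable_exp_Z:
  assumes "0 \<le> Re v"
  shows "complex_integrable Q (\<lambda>x. exp (- v * complex_of_real (Z x)))"
  using AE_norm_exp_le_1[OF assms] by (intro integrable_const_bound[where B = 1]) auto

lemma norm_laplace_transform_le_1:
  assumes "0 \<le> Re v"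
  shows "norm (laplace_transform Q Z v) \<le> 1"
proof -
  have "norm (laplace_transform Q Z v) \<le> (LINT x|Q. norm (exp (- v * complex_of_real (Z x))))"
    unfolding laplace_transform_def by (rule integral_norm_bound)
  also have "\<dots> \<le> (LINT x|Q. 1)"
    using AE_norm_exp_le_1[OF assms] integrable_exp_Z[OF assms]
    by (intro integral_mono_AE integrable_norm) auto
  finally show ?thesis by (simp add: prob_space)
qed

lemma continuous_on_laplace_transform: "continuous_on {v. 0 \<le> Re v} (laplace_transform Q Z)"
  unfolding continuous_on_sequentially
proof (intro ballI allI impI, elim conjE)
  fix v :: "nat \<Rightarrow> complex" and a
  assume v: "\<forall>n. v n \<in> {v. 0 \<le> Re v}" "v \<longlonglongrightarrow> a"
  show "(laplace_transform Q Z \<circ> v) \<longlonglongrightarrow> laplace_transform Q Z a"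
    unfolding laplace_transform_def comp_def
  proof (rule integral_dominated_convergence[where w = "\<lambda>_. 1"])
    show "AE x in Q. norm (exp (- v n * complex_of_real (Z x))) \<le> 1" for n
      using v by (intro AE_norm_exp_le_1) auto
    show "AE x in Q. (\<lambda>n. exp (- v n * complex_of_real (Z x))) \<longlonglongrightarrow> exp (- a * complex_of_real (Z x))"
      using v(2) by (intro AE_I2 tendsto_intros)
  qed auto
qed

text \<open>When Re v grows to infinity, \<open>exp (- v Z)\<close> tends to 0 almost surely because
  Z > 0, so \<phi> tends to 0 by dominated convergence, whatever Im v does. An atom of Z at 0 would
  leave a positive limit.\<close>

lemma laplace_transform_ge_half_imp_bounded:
  "\<exists>B. \<forall>v. 0 \<le> Re v \<longrightarrow> 1 / 2 \<le> norm (laplace_transform Q Z v) \<longrightarrow> Re v \<le> B"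
proof (rule ccontr)
  assume "\<nexists>B. \<forall>v. 0 \<le> Re v \<longrightarrow> 1 / 2 \<le> norm (laplace_transform Q Z v) \<longrightarrow> Re v \<le> B"
  then have "\<forall>n::nat. \<exists>v. 0 \<le> Re v \<and> 1 / 2 \<le> norm (laplace_transform Q Z v) \<and> real n < Re v"
    by (meson not_le)
  then obtain v where v: "\<And>n::nat. 0 \<le> Re (v n)" "\<And>n. 1 / 2 \<le> norm (laplace_transform Q Z (v n))"
    "\<And>n::nat. real n < Re (v n)"
    by metis
  have Re_v: "filterlim (\<lambda>n. Re (v n)) at_top sequentially"
    by (rule filterlim_at_top_mono[OF filterlim_real_sequentially])
      (use v(3) in \<open>auto intro!: always_eventually less_imp_le\<close>)
  have "(\<lambda>n. laplace_transform Q Z (v n)) \<longlonglongrightarrow> (CLINT x|Q. 0)"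
    unfolding laplace_transform_def
  proof (rule integral_dominated_convergence[where w = "\<lambda>_. 1"])
    show "AE x in Q. norm (exp (- v n * complex_of_real (Z x))) \<le> 1" for n
      using v by (intro AE_norm_exp_le_1) auto
    show "AE x in Q. (\<lambda>n. exp (- v n * complex_of_real (Z x))) \<longlonglongrightarrow> 0"
      using Z_pos
    proof eventually_elim
      fix x assume "0 < Z x"
      then have "filterlim (\<lambda>n. Re (v n) * Z x) at_top sequentially"
        using Re_v filterlim_at_top_mult_tendsto_pos[OF tendsto_const \<open>0 < Z x\<close> Re_v]
        by (simp add: mult.commute)
      then have "(\<lambda>n. exp (- (Re (v n) * Z x))) \<longlonglongrightarrow> 0"
        by (intro filterlim_compose[OF exp_at_bot] filterlim_uminus_at_bot[THEN iffD2]) auto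
      then show "(\<lambda>n. exp (- v n * complex_of_real (Z x))) \<longlonglongrightarrow> 0"
        by (subst tendsto_norm_zero_iff[symmetric]) simp
    qed
  qed auto
  then have "(\<lambda>n. norm (laplace_transform Q Z (v n))) \<longlonglongrightarrow> 0"
    by (simp add: tendsto_norm_zero)
  then have "1 / 2 \<le> (0::real)"
    using v(2) by (intro tendsto_lowerbound[where F = sequentially]) auto
  then show False by simp
qed

text \<open>If \<open>\<phi> v = 1\<close> with \<open>v \<noteq> 0\<close>, then \<open>exp (- v Z) = 1\<close> almost surely, so \<open>Z \<ge> 2 \<pi> / |v|\<close>
  almost surely; this cannot hold for arbitrarily small \<open>v\<close>.\<close>

lemma laplace_transform_eq_1_imp:
  assumes "0 \<le> Re v" "v \<noteq> 0" "laplace_transform Q Z v = 1"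
  shows "AE x in Q. 2 * pi \<le> norm v * Z x"
proof -
  define e where "e x = exp (- v * complex_of_real (Z x))" for x
  have int: "complex_integrable Q e"
    unfolding e_def using assms(1) by (rule integrable_exp_Z)
  have le1: "AE x in Q. norm (e x) \<le> 1"
    unfolding e_def using assms(1) by (rule AE_norm_exp_le_1)
  \<comment> \<open>A nonnegative function with integral 0 vanishes almost surely, so Re e = 1;
    together with |e| \<le> 1 this leaves no imaginary part.\<close>
  have "(LINT x|Q. 1 - Re (e x)) = 1 - Re (laplace_transform Q Z v)"
    using int unfolding laplace_transform_def e_def[symmetric] by (simp add: prob_space)
  also have "\<dots> = 0" using assms by simp
  finally have "(LINT x|Q. 1 - Re (e x)) = 0" .
  moreover have "AE x in Q. 0 \<le> 1 - Re (e x)"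
    using le1 by eventually_elim (use complex_Re_le_cmod order_trans in fastforce)
  moreover have "integrable Q (\<lambda>x. 1 - Re (e x))"
    using int by auto
  ultimately have "AE x in Q. 1 - Re (e x) = 0"
    using integral_nonneg_eq_0_iff_AE by blast
  with le1 Z_pos show ?thesis
  proof eventually_elim
    fix x assume x: "norm (e x) \<le> 1" "0 < Z x" "1 - Re (e x) = 0"
    then have "(Re (e x))\<^sup>2 + (Im (e x))\<^sup>2 \<le> 1"
      unfolding cmod_def by simp
    then have "e x = 1"
      using x by (simp add: complex_eq_iff)
    then obtain n :: int where n: "Im (- v * complex_of_real (Z x)) = of_int (2 * n) * pi"
      "Re (- v * complex_of_real (Z x)) = 0"
      unfolding e_def using exp_eq_1 by blast
    have "n \<noteq> 0"
      using n assms(2) x(2) by (auto simp: complex_eq_iff)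
    have "2 * pi \<le> \<bar>of_int (2 * n) * pi\<bar>"
      using \<open>n \<noteq> 0\<close> by (simp add: abs_mult)
    also have "\<dots> \<le> norm (- v * complex_of_real (Z x))"
      unfolding n(1)[symmetric] by (rule abs_Im_le_cmod)
    finally show "2 * pi \<le> norm v * Z x"
      using x(2) by (simp add: norm_mult)
  qed
qed

text \<open>Solutions of norm at most \<open>1 / Suc n\<close> for every n would force Z to exceed
  every bound almost surely. Only a neighbourhood of 0 can be cleared: for Z = 1, \<phi> equals 1 at
  every integer multiple of 2 pi i.\<close>

lemma laplace_transform_neq_1_near_0:
  "\<exists>r>0. \<forall>v. 0 \<le> Re v \<longrightarrow> v \<noteq> 0 \<longrightarrow> norm v \<le> r \<longrightarrow> laplace_transform Q Z v \<noteq> 1"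
proof (rule ccontr)
  assume *: "\<not> (\<exists>r>0. \<forall>v. 0 \<le> Re v \<longrightarrow> v \<noteq> 0 \<longrightarrow> norm v \<le> r \<longrightarrow> laplace_transform Q Z v \<noteq> 1)"
  have "AE x in Q. \<forall>n::nat. 2 * pi * Suc n \<le> Z x"
    unfolding AE_all_countable
  proof
    fix n :: nat
    have "(0::real) < 1 / Suc n" by simp
    with * obtain v where v: "0 \<le> Re v" "v \<noteq> 0" "norm v \<le> 1 / Suc n" "laplace_transform Q Z v = 1"
      by blast
    show "AE x in Q. 2 * pi * Suc n \<le> Z x"
      using laplace_transform_eq_1_imp[OF v(1,2,4)] Z_pos
    proof eventually_elim
      fix x assume "2 * pi \<le> norm v * Z x" "0 < Z x"
      moreover have "norm v * Z x \<le> 1 / Suc n * Z x"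
        using v(3) \<open>0 < Z x\<close> by (intro mult_right_mono) auto
      ultimately have "2 * pi \<le> 1 / Suc n * Z x" by simp
      then show "2 * pi * Suc n \<le> Z x"
        by (simp add: pos_le_divide_eq)
    qed
  qed
  then have "AE x in Q. False"
  proof eventually_elim
    fix x assume *: "\<forall>n::nat. 2 * pi * Suc n \<le> Z x"
    obtain n :: nat where "Z x < real n" using reals_Archimedean2 by blast
    also have "real n \<le> real (Suc n)" by simp
    also have "\<dots> \<le> 2 * pi * Suc n"
      using pi_gt3 by (intro mult_le_cancel_right1[THEN iffD2]) auto
    finally show False using * by (meson not_le)
  qed
  then show False by simp
qed

end

section \<open>Characteristic functions\<close>

context real_distribution
begin

lemma integrable_iexp_mult: "complex_integrable M (\<lambda>x. iexp (t * x))"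
  by (intro integrable_const_bound[where B = 1]) auto

text \<open>Pointwise, \<open>|1 - iexp y|\<^sup>2 = 2 (1 - cos y)\<close>. Thus second moments of
  \<open>1 - iexp (t x)\<close> can be read off from the characteristic function.\<close>

lemma Re_one_minus_char: "2 * Re (1 - char M t) = (LINT x|M. (norm (1 - iexp (t * x)))\<^sup>2)"
proof -
  have *: "(norm (1 - iexp y))\<^sup>2 = 2 * (1 - Re (iexp y))" for y :: real
  proof -
    have "(norm (1 - iexp y))\<^sup>2 = (1 - cos y)\<^sup>2 + (sin y)\<^sup>2"
      unfolding cis_conv_exp[symmetric] by (simp add: cmod_power2)
    also have "\<dots> = 1 - 2 * cos y + ((sin y)\<^sup>2 + (cos y)\<^sup>2)"
      by (simp add: power2_eq_square algebra_simps)
    finally show ?thesis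
      unfolding cis_conv_exp[symmetric] by simp
  qed
  have "(LINT x|M. (norm (1 - iexp (t * x)))\<^sup>2) = 2 * (LINT x|M. 1 - Re (iexp (t * x)))"
    unfolding * by (rule integral_mult_right_zero)
  also have "(LINT x|M. 1 - Re (iexp (t * x))) = 1 - Re (CLINT x|M. iexp (t * x))"
    using integrable_iexp_mult[of t] prob_space
    by (subst Bochner_Integration.integral_diff) (auto simp del: of_real_mult)
  finally show ?thesis
    by (simp add: char_def)
qed

text \<open>The integrand \<open>(1 - a b) - (1 - a) - (1 - b) = - (1 - a) (1 - b)\<close> is estimated by
  the weighted inequality of arithmetic and geometric means.\<close>

lemma char_increment_weighted:
  assumes "0 < c"
  shows "norm ((1 - char M (u + h)) - (1 - char M u) - (1 - char M h))
    \<le> c * Re (1 - char M u) + Re (1 - char M h) / c"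
proof -
  define a b where "a x = 1 - iexp (u * x)" and "b x = 1 - iexp (h * x)" for x :: real
  have bound: "norm (a x) \<le> 2" "norm (b x) \<le> 2" for x
    unfolding a_def b_def by (rule order_trans[OF norm_triangle_ineq4], simp)+
  have [measurable]: "a \<in> borel_measurable M" "b \<in> borel_measurable M"
    unfolding a_def b_def by auto
  have int: "integrable M (\<lambda>x. (norm (a x))\<^sup>2)" "integrable M (\<lambda>x. (norm (b x))\<^sup>2)"
    by (intro integrable_const_bound[where B = "2\<^sup>2"] AE_I2;
      use bound in \<open>simp add: abs_le_square_iff[symmetric] del: power_numeral\<close>)+
  have int_ab: "complex_integrable M (\<lambda>x. a x * b x)"
  proof (intro integrable_const_bound[where B = "2 * 2"] AE_I2)
    show "norm (a x * b x) \<le> 2 * 2" for x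
      unfolding norm_mult using bound by (intro mult_mono) auto
  qed auto
  have "(1 - char M (u + h)) - (1 - char M u) - (1 - char M h)
      = (CLINT x|M. iexp (u * x)) + (CLINT x|M. iexp (h * x)) - (CLINT x|M. iexp ((u + h) * x)) - 1"
    by (simp add: char_def)
  also have "\<dots> = (CLINT x|M. iexp (u * x) + iexp (h * x) - iexp ((u + h) * x) - 1)"
    using integrable_iexp_mult prob_space
    by (simp del: of_real_mult of_real_add)
  also have "\<dots> = (CLINT x|M. - (a x * b x))"
    by (intro Bochner_Integration.integral_cong)
      (simp_all add: a_def b_def algebra_simps exp_add)
  finally have "norm ((1 - char M (u + h)) - (1 - char M u) - (1 - char M h))
      = norm (CLINT x|M. a x * b x)" by simp
  also have "\<dots> \<le> (LINT x|M. norm (a x * b x))"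
    by (rule integral_norm_bound)
  also have "\<dots> \<le> (LINT x|M. c / 2 * (norm (a x))\<^sup>2 + 1 / (2 * c) * (norm (b x))\<^sup>2)"
  proof (intro integral_mono integrable_norm int_ab Bochner_Integration.integrable_add
      integrable_mult_right int)
    fix x
    have "0 \<le> (c * norm (a x) - norm (b x))\<^sup>2 / (2 * c)"
      using assms by simp
    also have "\<dots> = c / 2 * (norm (a x))\<^sup>2 + 1 / (2 * c) * (norm (b x))\<^sup>2 - norm (a x) * norm (b x)"
      using assms by (simp add: field_simps power2_eq_square)
    finally show "norm (a x * b x) \<le> c / 2 * (norm (a x))\<^sup>2 + 1 / (2 * c) * (norm (b x))\<^sup>2"
      by (simp add: norm_mult)
  qed
  also have "\<dots> = c / 2 * (2 * Re (1 - char M u)) + 1 / (2 * c) * (2 * Re (1 - char M h))"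
    unfolding Re_one_minus_char a_def[symmetric] b_def[symmetric]
    using int by (subst Bochner_Integration.integral_add) (auto simp del: norm_power)
  also have "\<dots> = c * Re (1 - char M u) + Re (1 - char M h) / c"
    using assms by (simp add: field_simps)
  finally show ?thesis .
qed

text \<open>Minimising the weighted bound over c gives \<open>c = sqrt (B / A)\<close> and the value
  \<open>2 sqrt (A B)\<close>. If A or B is 0 this weight degenerates, and c is sent to infinity or
  to 0 instead.\<close>

lemma char_increment:
  "norm ((1 - char M (u + h)) - (1 - char M u) - (1 - char M h))
    \<le> 2 * sqrt (norm (1 - char M u) * norm (1 - char M h))"
proof -
  define A where "A = norm (1 - char M u)"
  define B where "B = norm (1 - char M h)"
  have AB: "Re (1 - char M u) \<le> A" "Re (1 - char M h) \<le> B" "0 \<le> A" "0 \<le> B"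
    unfolding A_def B_def by (rule complex_Re_le_cmod norm_ge_zero)+
  show ?thesis
  proof (cases "A = 0 \<or> B = 0")
    case True
    then have "char M u = 1 \<or> char M h = 1"
      by (auto simp: A_def B_def)
    then have "norm ((1 - char M (u + h)) - (1 - char M u) - (1 - char M h)) \<le> 0"
    proof
      assume "char M u = 1"
      then have "norm ((1 - char M (u + h)) - (1 - char M u) - (1 - char M h)) \<le> e" if "0 < e" for e
      proof -
        have "0 < B / e + 1" using that AB by (simp add: add_nonneg_pos)
        from char_increment_weighted[OF this, of u h] \<open>char M u = 1\<close>
        have "norm ((1 - char M (u + h)) - (1 - char M u) - (1 - char M h)) \<le> Re (1 - char M h) / (B / e + 1)"
          by simp
        also have "\<dots> \<le> B / (B / e + 1)"
          using AB that by (intro divide_right_mono) auto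
        also have "\<dots> \<le> e"
          using AB that by (simp add: field_simps add_nonneg_pos)
        finally show ?thesis .
      qed
      then show ?thesis by (rule field_le_epsilon[of _ 0, simplified])
    next
      assume "char M h = 1"
      then have "norm ((1 - char M (u + h)) - (1 - char M u) - (1 - char M h)) \<le> e" if "0 < e" for e
      proof -
        have "0 < e / (A + 1)" using that AB by simp
        from char_increment_weighted[OF this, of u h] \<open>char M h = 1\<close>
        have "norm ((1 - char M (u + h)) - (1 - char M u) - (1 - char M h)) \<le> e / (A + 1) * Re (1 - char M u)"
          by simp
        also have "\<dots> \<le> e / (A + 1) * A"
          using AB that by (intro mult_left_mono) auto
        also have "\<dots> \<le> e"
          using AB that by (simp add: field_simps)
        finally show ?thesis .
      qed
      then show ?thesis by (rule field_le_epsilon[of _ 0, simplified])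
    qed
    then show ?thesis
      by (smt (verit) mult_nonneg_nonneg norm_ge_zero real_sqrt_ge_zero)
  next
    case False
    then have pos: "0 < A" "0 < B" using AB by auto
    define c where "c = sqrt B / sqrt A"
    have "c > 0" using pos by (simp add: c_def)
    have "norm ((1 - char M (u + h)) - (1 - char M u) - (1 - char M h))
        \<le> c * Re (1 - char M u) + Re (1 - char M h) / c"
      using \<open>c > 0\<close> by (rule char_increment_weighted)
    also have "\<dots> \<le> c * A + B / c"
      using AB \<open>c > 0\<close> by (intro add_mono mult_left_mono divide_right_mono) auto
    also have "c * A = sqrt (A * B)"
      using pos by (simp add: c_def real_sqrt_mult field_simps)
    also have "B / c = sqrt (A * B)"
      using pos by (simp add: c_def real_sqrt_mult field_simps)
    finally show ?thesis
      by (simp add: A_def B_def)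
  qed
qed

text \<open>The triangle inequality and the increment bound add up to the complete square
  \<open>(sqrt a + sqrt b)\<^sup>2\<close>.\<close>

lemma sqrt_one_minus_char_add:
  "sqrt (norm (1 - char M (u + h))) \<le> sqrt (norm (1 - char M u)) + sqrt (norm (1 - char M h))"
proof (rule real_le_lsqrt)
  have "norm (1 - char M (u + h)) = norm (((1 - char M (u + h)) - (1 - char M u) - (1 - char M h))
      + (1 - char M u) + (1 - char M h))" by simp
  also have "\<dots> \<le> norm ((1 - char M (u + h)) - (1 - char M u) - (1 - char M h))
      + norm (1 - char M u) + norm (1 - char M h)"
    by (meson add_mono_thms_linordered_semiring(3) norm_triangle_ineq norm_triangle_mono order_refl)
  also have "\<dots> \<le> 2 * sqrt (norm (1 - char M u) * norm (1 - char M h))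
      + norm (1 - char M u) + norm (1 - char M h)"
    using char_increment by simp
  also have "\<dots> = (sqrt (norm (1 - char M u)) + sqrt (norm (1 - char M h)))\<^sup>2"
    by (simp add: power2_sum real_sqrt_mult)
  finally show "norm (1 - char M (u + h)) \<le> \<dots>" .
qed auto

lemma sqrt_one_minus_char_mult:
  "sqrt (norm (1 - char M (real m * u))) \<le> real m * sqrt (norm (1 - char M u))"
proof (induction m)
  case (Suc m)
  have "sqrt (norm (1 - char M (real (Suc m) * u)))
      \<le> sqrt (norm (1 - char M (real m * u))) + sqrt (norm (1 - char M u))"
    using sqrt_one_minus_char_add[of "real m * u" u] by (simp add: algebra_simps)
  with Suc show ?case by (simp add: algebra_simps)
qed (simp add: char_zero)

text \<open>The factor \<open>m\<^sup>2\<close> is the same for all distributions, so the bound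
  survives division by \<theta>; it carries estimates near 0 to every frequency.\<close>

lemma norm_one_minus_char_mult:
  "norm (1 - char M (real m * u)) \<le> (real m)\<^sup>2 * norm (1 - char M u)"
  using power_mono[OF sqrt_one_minus_char_mult[of m u], of 2]
  by (simp add: power_mult_distrib)

end

section \<open>Weak convergence, tightness and the continuity theorem\<close>

lemma norm_one_minus_iexp_le: "norm (1 - iexp y) \<le> min 2 \<bar>y\<bar>" for y :: real
proof -
  have "norm (1 - iexp y) \<le> 2"
    by (rule order_trans[OF norm_triangle_ineq4]) simp
  moreover have "norm (iexp y - (\<Sum>k\<le>0. (\<i> * y)^k / fact k)) \<le> \<bar>y\<bar>^Suc 0 / fact (Suc 0)"
    by (rule iexp_approx1)
  ultimately show ?thesis
    by (simp add: norm_minus_commute)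
qed

text \<open>For |u| \<le> d the integrand \<open>|1 - iexp (u x)|\<close> is at most
  \<open>min 2 (d |x|)\<close>, which is independent of u. This majorant is bounded and continuous
  in x, so its integral passes to the weak limit, where it is small for small d.\<close>

lemma weak_conv_m_char_near_0:
  assumes M: "\<And>n. real_distribution (M n)" and L: "real_distribution L"
    and conv: "weak_conv_m M L" and "0 < e"
  shows "\<exists>d>0. \<forall>\<^sub>F n in sequentially. \<forall>u. \<bar>u\<bar> \<le> d \<longrightarrow> norm (1 - char (M n) u) < e"
proof -
  interpret L: real_distribution L by fact
  define T where "T d x = min 2 (d * \<bar>x\<bar>)" for d x :: real
  have T_meas [measurable]: "T d \<in> borel_measurable borel" for d
    unfolding T_def by measurable
  have T_bound: "norm (T d x) \<le> 2" if "0 \<le> d" for d x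
    using that by (auto simp: T_def min_def)
  have "(\<lambda>m. LINT x|L. T (1 / Suc m) x) \<longlonglongrightarrow> (LINT x|L. 0)"
  proof (rule integral_dominated_convergence[where w = "\<lambda>_. 2"])
    show "AE x in L. (\<lambda>m. T (1 / Suc m) x) \<longlonglongrightarrow> 0"
    proof (rule AE_I2)
      fix x :: real
      have "(\<lambda>m. min 2 (1 / Suc m * \<bar>x\<bar>)) \<longlonglongrightarrow> min 2 (0 * \<bar>x\<bar>)"
        using LIMSEQ_inverse_real_of_nat by (intro tendsto_intros) (simp add: inverse_eq_divide)
      then show "(\<lambda>m. T (1 / Suc m) x) \<longlonglongrightarrow> 0" by (simp add: T_def)
    qed
  qed (use T_bound in auto)
  then have "(\<lambda>m. LINT x|L. T (1 / Suc m) x) \<longlonglongrightarrow> 0" by simp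
  then have "\<forall>\<^sub>F m in sequentially. (LINT x|L. T (1 / Suc m) x) < e"
    using \<open>0 < e\<close> by (rule order_tendstoD)
  then obtain m where m: "(LINT x|L. T (1 / Suc m) x) < e"
    by (meson eventually_happens trivial_limit_sequentially)
  define d :: real where "d = 1 / Suc m"
  have "d > 0" by (simp add: d_def)
  have "(\<lambda>n. LINT x|M n. T d x) \<longlonglongrightarrow> (LINT x|L. T d x)"
    by (rule weak_conv_imp_integral_bdd_continuous_conv[OF M L conv, where B = 2])
      (use T_bound \<open>d > 0\<close> in \<open>auto simp: T_def intro!: continuous_intros\<close>)
  then have "\<forall>\<^sub>F n in sequentially. (LINT x|M n. T d x) < e"
    using m unfolding d_def by (rule order_tendstoD)
  then have "\<forall>\<^sub>F n in sequentially. \<forall>u. \<bar>u\<bar> \<le> d \<longrightarrow> norm (1 - char (M n) u) < e"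
  proof eventually_elim
    fix n assume n: "(LINT x|M n. T d x) < e"
    interpret Mn: real_distribution "M n" by (rule M)
    show "\<forall>u. \<bar>u\<bar> \<le> d \<longrightarrow> norm (1 - char (M n) u) < e"
    proof (intro allI impI)
      fix u :: real assume u: "\<bar>u\<bar> \<le> d"
      have int: "complex_integrable (M n) (\<lambda>x. iexp (u * x))"
        by (intro Mn.integrable_const_bound[where B = 1]) auto
      have "1 - char (M n) u = (CLINT x|M n. 1 - iexp (u * x))"
        unfolding char_def using int Mn.prob_space
        by (subst Bochner_Integration.integral_diff) (auto simp del: of_real_mult)
      then have "norm (1 - char (M n) u) \<le> (LINT x|M n. norm (1 - iexp (u * x)))"
        by (simp add: integral_norm_bound del: of_real_mult)
      also have "\<dots> \<le> (LINT x|M n. T d x)"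
      proof (rule integral_mono)
        show "integrable (M n) (\<lambda>x. norm (1 - iexp (u * x)))"
          using int by (simp del: of_real_mult)
        show "integrable (M n) (T d)"
          using T_bound \<open>d > 0\<close> by (intro Mn.integrable_const_bound[where B = 2]) auto
        show "norm (1 - iexp (u * x)) \<le> T d x" for x
          using norm_one_minus_iexp_le[of "u * x"] mult_right_mono[OF u, of "\<bar>x\<bar>"]
          by (simp add: T_def abs_mult)
      qed
      finally show "norm (1 - char (M n) u) < e" using n by simp
    qed
  qed
  then show ?thesis using \<open>d > 0\<close> by blast
qed

text \<open>Averaging over a Gaussian frequency bounds the tails of a distribution by its characteristic
  function.\<close>

lemma (in real_distribution) measure_tail_le_gaussian_average:
  assumes "0 < s"
  shows "measure M {x. 2 / s \<le> \<bar>x\<bar>} \<le> 2 * (LINT y|std_normal_distribution. Re (1 - char M (s * y)))"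
proof -
  interpret N: real_distribution std_normal_distribution
    by (rule real_dist_normal_dist)
  interpret P: pair_sigma_finite M std_normal_distribution ..
  interpret PP: pair_prob_space M std_normal_distribution ..
  have "complex_integrable (M \<Otimes>\<^sub>M std_normal_distribution) (\<lambda>(x, y). iexp (s * y * x))"
    by (intro PP.P.integrable_const_bound[where B = 1]) (auto simp: split_beta')
  \<comment> \<open>Exchanging the integrals turns the average over y into the Gaussian
    characteristic function at \<open>s * x\<close>, a real exponential.\<close>
  from P.Fubini_integral[OF this]
  have "(CLINT y|std_normal_distribution. char M (s * y))
      = (CLINT x|M. char std_normal_distribution (s * x))"
    by (simp add: char_def mult_ac)
  also have "\<dots> = (CLINT x|M. complex_of_real (exp (- ((s * x)\<^sup>2) / 2)))"
    by (simp add: char_std_normal_distribution)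
  also have "\<dots> = complex_of_real (LINT x|M. exp (- ((s * x)\<^sup>2) / 2))"
    by (rule integral_complex_of_real)
  finally have eq: "Re (CLINT y|std_normal_distribution. char M (s * y))
      = (LINT x|M. exp (- ((s * x)\<^sup>2) / 2))" by simp
  have int: "complex_integrable std_normal_distribution (\<lambda>y. char M (s * y))"
    using cmod_char_le_1 by (intro N.integrable_const_bound[where B = 1]) auto
  have int': "integrable M (\<lambda>x. exp (- ((s * x)\<^sup>2) / 2))"
    by (intro integrable_const_bound[where B = 1]) auto
  have "measure M {x. 2 / s \<le> \<bar>x\<bar>} = (LINT x|M. indicator {x. 2 / s \<le> \<bar>x\<bar>} x)"
    by simp
  also have "\<dots> \<le> (LINT x|M. 2 * (1 - exp (- ((s * x)\<^sup>2) / 2)))"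
  proof (rule integral_mono)
    fix x
    show "indicator {x. 2 / s \<le> \<bar>x\<bar>} x \<le> 2 * (1 - exp (- ((s * x)\<^sup>2) / 2))"
    proof (cases "2 / s \<le> \<bar>x\<bar>")
      \<comment> \<open>Here the exponential is at most 1 / 2, so the factor 2 makes the right-hand
        side at least 1.\<close>
      case True
      then have "2 \<le> \<bar>s * x\<bar>" using assms by (simp add: field_simps abs_mult)
      then have "2\<^sup>2 \<le> (s * x)\<^sup>2" by (metis abs_le_square_iff abs_numeral)
      then have "exp (- ((s * x)\<^sup>2) / 2) \<le> exp (- 1)" by simp
      also have "\<dots> \<le> 1 / (2::real)"
        using exp_ge_add_one_self[of 1] by (simp add: exp_minus field_simps)
      finally show ?thesis by (simp add: indicator_def)
    next
      case False
      then show ?thesis by simp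
    qed
  qed (use int' in \<open>auto simp: less_top[symmetric]\<close>)
  also have "\<dots> = 2 * (1 - (LINT x|M. exp (- ((s * x)\<^sup>2) / 2)))"
    using int' prob_space by (simp del: space_eq_univ)
  also have "\<dots> = 2 * Re (CLINT y|std_normal_distribution. 1 - char M (s * y))"
    using int N.prob_space by (simp add: eq del: N.space_eq_univ)
  also have "\<dots> = 2 * (LINT y|std_normal_distribution. Re (1 - char M (s * y)))"
    using int by (subst integral_Re) auto
  finally show ?thesis .
qed

text \<open>Unlike in \<open>levy_continuity\<close>, the limit function is not assumed to be a characteristic
  function.\<close>

theorem levy_continuity_char_fun:
  fixes M :: "nat \<Rightarrow> real measure"
  assumes M: "\<And>n. real_distribution (M n)"
    and conv: "\<And>t. (\<lambda>n. char (M n) t) \<longlonglongrightarrow> \<xi> t"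
    and cont: "isCont \<xi> 0"
  shows "char_fun \<xi>"
proof -
  interpret N: real_distribution std_normal_distribution
    by (rule real_dist_normal_dist)
  interpret M: real_distribution "M n" for n by (rule M)
  define I where "I n s = (LINT y|std_normal_distribution. Re (1 - char (M n) (s * y)))" for n s
  define J where "J s = (LINT y|std_normal_distribution. Re (1 - \<xi> (s * y)))" for s
  have \<xi>0: "\<xi> 0 = 1"
    using LIMSEQ_unique[OF conv[of 0]] by (simp add: M.char_zero)
  have [measurable]: "\<xi> \<in> borel_measurable borel"
    by (rule borel_measurable_LIMSEQ_metric[OF M.char_measurable conv])
  have \<xi>_le: "norm (\<xi> t) \<le> 1" for t
    using conv[of t] M.cmod_char_le_1
    by (intro tendsto_upperbound[OF tendsto_norm]) (auto intro: always_eventually)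
  have bound2: "\<bar>Re (1 - z)\<bar> \<le> 2" if "norm z \<le> 1" for z
    using that abs_Re_le_cmod[of "1 - z"] norm_triangle_ineq4[of 1 z] by simp
  have I_J: "(\<lambda>n. I n s) \<longlonglongrightarrow> J s" for s
    unfolding I_def J_def
  proof (rule integral_dominated_convergence[where w = "\<lambda>_. 2"])
    show "AE y in std_normal_distribution. norm (Re (1 - char (M n) (s * y))) \<le> 2" for n
      using bound2[OF M.cmod_char_le_1] by auto
    show "AE y in std_normal_distribution. (\<lambda>n. Re (1 - char (M n) (s * y))) \<longlonglongrightarrow> Re (1 - \<xi> (s * y))"
      by (intro AE_I2 tendsto_intros conv)
  qed auto
  have J_0: "(\<lambda>m. J (1 / Suc m)) \<longlonglongrightarrow> (LINT y|std_normal_distribution. 0)"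
    unfolding J_def
  proof (rule integral_dominated_convergence[where w = "\<lambda>_. 2"])
    show "AE y in std_normal_distribution. norm (Re (1 - \<xi> (1 / Suc m * y))) \<le> 2" for m
      using bound2[OF \<xi>_le] by auto
    show "AE y in std_normal_distribution. (\<lambda>m. Re (1 - \<xi> (1 / Suc m * y))) \<longlonglongrightarrow> 0"
    proof (rule AE_I2)
      fix y :: real
      have "(\<lambda>m. 1 / Suc m * y) \<longlonglongrightarrow> 0 * y"
        using LIMSEQ_inverse_real_of_nat by (intro tendsto_intros) (simp add: inverse_eq_divide)
      then have "(\<lambda>m. \<xi> (1 / Suc m * y)) \<longlonglongrightarrow> \<xi> 0"
        by (intro isCont_tendsto_compose[OF cont]) simp
      then have "(\<lambda>m. Re (1 - \<xi> (1 / Suc m * y))) \<longlonglongrightarrow> Re (1 - \<xi> 0)"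
        by (intro tendsto_intros)
      then show "(\<lambda>m. Re (1 - \<xi> (1 / Suc m * y))) \<longlonglongrightarrow> 0" by (simp add: \<xi>0)
    qed
  qed auto
  \<comment> \<open>Continuity of \<xi> at 0 makes \<open>J s\<close> small for some small s, hence
    \<open>I n s\<close> small for all large n, which bounds the mass outside radius
    \<open>2 / s\<close>. The finitely many remaining n are covered by enlarging K.\<close>
  have "tight M"
    unfolding tight_def
  proof (intro conjI allI impI M)
    fix e :: real assume "0 < e"
    have "\<forall>\<^sub>F m in sequentially. J (1 / Suc m) < e / 2"
      using J_0 \<open>0 < e\<close> by (intro order_tendstoD) auto
    then obtain m where m: "J (1 / Suc m) < e / 2"
      by (meson eventually_happens trivial_limit_sequentially)
    define s :: real where "s = 1 / Suc m"
    have "s > 0" by (simp add: s_def)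
    have "\<forall>\<^sub>F n in sequentially. I n s < e / 2"
      using I_J m unfolding s_def by (rule order_tendstoD)
    then obtain n0 where n0: "\<And>n. n \<ge> n0 \<Longrightarrow> I n s < e / 2"
      by (auto simp: eventually_sequentially)
    have "\<forall>\<^sub>F K in at_top. \<forall>n\<in>{..<n0}. 1 - e < measure (M n) {- K<..K}"
    proof (intro eventually_ball_finite ballI)
      fix n
      have "((\<lambda>K. cdf (M n) K - cdf (M n) (- K)) \<longlongrightarrow> 1 - 0) at_top"
        by (intro tendsto_diff M.cdf_lim_at_top_prob
            filterlim_compose[OF M.cdf_lim_at_bot] filterlim_uminus_at_bot_at_top)
      then have "\<forall>\<^sub>F K in at_top. 1 - e < cdf (M n) K - cdf (M n) (- K)"
        using \<open>0 < e\<close> by (intro order_tendstoD) auto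
      then show "\<forall>\<^sub>F K in at_top. 1 - e < measure (M n) {- K<..K}"
        using eventually_gt_at_top[of 0]
        by eventually_elim (simp add: M.cdf_diff_eq)
    qed simp
    with eventually_ge_at_top[of "2 / s"]
    have "\<forall>\<^sub>F K in at_top. 2 / s \<le> K \<and> (\<forall>n\<in>{..<n0}. 1 - e < measure (M n) {- K<..K})"
      by eventually_elim simp
    then obtain K where K: "2 / s \<le> K" "\<And>n. n < n0 \<Longrightarrow> 1 - e < measure (M n) {- K<..K}"
      using eventually_happens[of _ "at_top :: real filter"] by force
    have "K > 0" using K(1) \<open>s > 0\<close> by (smt (verit) divide_pos_pos)
    have "1 - e < measure (M n) {- K<..K}" for n
    proof (cases "n < n0")
      case False
      have "measure (M n) {x. 2 / s \<le> \<bar>x\<bar>} < e"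
        using M.measure_tail_le_gaussian_average[OF \<open>s > 0\<close>, of n] n0[of n] False
        by (simp add: I_def)
      then have "1 - e < measure (M n) (space (M n) - {x. 2 / s \<le> \<bar>x\<bar>})"
        by (subst M.prob_compl) auto
      also have "\<dots> \<le> measure (M n) {- K<..K}"
        using K(1) by (intro M.finite_measure_mono) (auto simp: abs_if split: if_splits)
      finally show ?thesis .
    qed (use K in auto)
    then show "\<exists>a b. a < b \<and> (\<forall>n. 1 - e < measure (M n) {a<..b})"
      using \<open>K > 0\<close> by (intro exI[of _ "- K"] exI[of _ K]) auto
  qed
  \<comment> \<open>A weak limit point exists by tightness, and pointwise convergence forces its
    characteristic function to be \<xi>.\<close>
  from tight_imp_convergent_subsubsequence[OF this strict_mono_id]
  obtain r \<nu> where r: "strict_mono r" "real_distribution \<nu>" "weak_conv_m (M \<circ> r) \<nu>"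
    by auto
  have "char \<nu> t = \<xi> t" for t
  proof (rule LIMSEQ_unique)
    show "(\<lambda>n. char ((M \<circ> r) n) t) \<longlonglongrightarrow> char \<nu> t"
      by (rule levy_continuity1[OF _ r(2,3)]) (simp add: M)
    show "(\<lambda>n. char ((M \<circ> r) n) t) \<longlonglongrightarrow> \<xi> t"
      using LIMSEQ_subseq_LIMSEQ[OF conv r(1)] by (simp add: comp_def)
  qed
  then show ?thesis
    unfolding char_fun_def using r(2) by blast
qed

section \<open>Random sums\<close>

context prob_space
begin

text \<open>The partial sums equal \<open>Y (N x) x\<close> cut off to \<open>N x < m\<close>, so
  dominated convergence with bound 1 applies. It serves both for \<open>iexp\<close> of the random
  sum and for the powers \<open>z ^ N x\<close>.\<close>

lemma sums_expectation_split:
  fixes Y :: "nat \<Rightarrow> 'a \<Rightarrow> complex"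
  assumes N [measurable]: "N \<in> measurable M (count_space UNIV)"
    and Y [measurable]: "\<And>n. Y n \<in> borel_measurable M"
    and Y_le: "\<And>n x. norm (Y n x) \<le> 1"
  shows "(\<lambda>n. CLINT x|M. of_bool (N x = n) * Y n x) sums (CLINT x|M. Y (N x) x)"
proof -
  have [measurable]: "(\<lambda>x. Y (N x) x) \<in> borel_measurable M"
    by (rule measurable_compose_countable[OF Y N])
  have split: "(\<Sum>n<m. of_bool (N x = n) * Y n x) = (if N x < m then Y (N x) x else 0)" for m x
    by (simp add: of_bool_def if_distrib if_distribR sum.delta cong: if_cong)
  have int: "complex_integrable M (\<lambda>x. of_bool (N x = n) * Y n x)" for n
    using Y_le by (intro integrable_const_bound[where B = 1]) (auto simp: norm_mult of_bool_def)
  have "(\<lambda>m. CLINT x|M. (\<Sum>n<m. of_bool (N x = n) * Y n x)) \<longlonglongrightarrow> (CLINT x|M. Y (N x) x)"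
  proof (rule integral_dominated_convergence[where w = "\<lambda>_. 1"])
    show "AE x in M. (\<lambda>m. \<Sum>n<m. of_bool (N x = n) * Y n x) \<longlonglongrightarrow> Y (N x) x"
    proof (intro AE_I2 tendsto_eventually)
      show "\<forall>\<^sub>F m in sequentially. (\<Sum>n<m. of_bool (N x = n) * Y n x) = Y (N x) x" for x
        using eventually_gt_at_top[of "N x"] by eventually_elim (simp add: split)
    qed
    show "AE x in M. norm (\<Sum>n<m. of_bool (N x = n) * Y n x) \<le> 1" for m
      using Y_le by (simp add: split)
  qed auto
  then show ?thesis
    unfolding sums_def by (subst (asm) Bochner_Integration.integral_sum) (use int in auto)
qed

text \<open>Split by the value of N: independence gives
  \<open>E[1(N = n) exp (i u S n)] = P(N = n) f ^ n\<close>, and summing over n yields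
  \<open>E[f ^ N]\<close>. For n = 0 the empty sum matches \<open>f ^ 0 = 1\<close>.\<close>

lemma char_random_sum:
  fixes X :: "nat \<Rightarrow> 'a \<Rightarrow> real"
  assumes X_indep: "indep_vars (\<lambda>_. borel) X {1..}"
    and X_ident: "\<And>i. 1 \<le> i \<Longrightarrow> distr M borel (X i) = distr M borel (X 1)"
    and N [measurable]: "N \<in> measurable M (count_space UNIV)"
    and N_indep: "indep_set {N -` A \<inter> space M | A. True}
        (sigma_sets (space M) (\<Union>i\<in>{1..}. {X i -` B \<inter> space M | B. B \<in> sets borel}))"
  shows "real_distribution (distr M borel (\<lambda>x. \<Sum>i = 1..N x. X i x))"
    and "real_distribution (distr M borel (\<lambda>x. \<Sum>i = 1..m. X i x))"
    and "char (distr M borel (\<lambda>x. \<Sum>i = 1..m. X i x)) u = char (distr M borel (X 1)) u ^ m"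
    and "char (distr M borel (\<lambda>x. \<Sum>i = 1..N x. X i x)) u
      = (CLINT x|M. char (distr M borel (X 1)) u ^ N x)"
proof -
  define S where "S n x = (\<Sum>i = 1..n. X i x)" for n x
  define f where "f = char (distr M borel (X 1)) u"
  have X_meas [measurable]: "X i \<in> borel_measurable M" if "1 \<le> i" for i
    using X_indep that by (auto simp: indep_vars_def)
  have S_meas [measurable]: "S n \<in> borel_measurable M" for n
    unfolding S_def by measurable
  have SN_meas [measurable]: "(\<lambda>x. S (N x) x) \<in> borel_measurable M"
    by (rule measurable_compose_countable[OF S_meas N])
  show "real_distribution (distr M borel (\<lambda>x. \<Sum>i = 1..N x. X i x))"
    using SN_meas unfolding S_def by (rule real_distribution_distr)
  show "real_distribution (distr M borel (\<lambda>x. \<Sum>i = 1..m. X i x))" for m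
    using S_meas unfolding S_def by (rule real_distribution_distr)
  have char_S: "char (distr M borel (S n)) u = f ^ n" for n
  proof -
    have "char (distr M borel (S n)) u = (\<Prod>i = 1..n. char (distr M borel (X i)) u)"
      unfolding S_def by (intro char_distr_sum indep_vars_subset[OF X_indep]) auto
    also have "\<dots> = (\<Prod>i = 1..n. f)"
    proof (rule prod.cong)
      show "char (distr M borel (X i)) u = f" if "i \<in> {1..n}" for i
        using that by (subst X_ident) (auto simp: f_def)
    qed simp
    finally show ?thesis by simp
  qed
  then show "char (distr M borel (\<lambda>x. \<Sum>i = 1..m. X i x)) u = char (distr M borel (X 1)) u ^ m"
    unfolding S_def f_def .
  have f_le: "norm (f ^ n) \<le> 1" for n
    using real_distribution.cmod_char_le_1[OF real_distribution_distr[OF S_meas[of n]], of u]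
    by (simp add: char_S)
  \<comment> \<open>\<open>G\<close> is the sigma-algebra generated by all summands and
    \<open>V\<close>, defined below, the one generated by N. The exponential of a partial sum is
    measurable for \<open>G\<close> and the indicator of N = n for \<open>V\<close>, so they inherit
    the independence of the two.\<close>
  define G where "G = sigma (space M) (\<Union>i\<in>{1..}. {X i -` B \<inter> space M | B. B \<in> sets borel})"
  have sets_G: "sets G = sigma_sets (space M) (\<Union>i\<in>{1..}. {X i -` B \<inter> space M | B. B \<in> sets borel})"
    and space_G: "space G = space M"
    unfolding G_def by (auto intro!: sets_measure_of space_measure_of)
  have X_G: "X i \<in> borel_measurable G" if "1 \<le> i" for i
    using that by (intro measurableI) (auto simp: sets_G space_G intro!: sigma_sets.Basic)
  have S_G: "S n \<in> borel_measurable G" for n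
    unfolding S_def using X_G by (intro borel_measurable_sum) auto
  define V where "V = vimage_algebra (space M) N (count_space UNIV)"
  have sets_V: "sets V = {N -` A \<inter> space M | A. True}" and space_V: "space V = space M"
    unfolding V_def by (simp_all add: sets_vimage_algebra2)
  have N_V [measurable]: "N \<in> measurable V (count_space UNIV)"
    unfolding V_def by (rule measurable_vimage_algebra1) simp
  have sigma_sub: "sigma_sets (space M) {Y -` A \<inter> space M |A. A \<in> sets borel} \<subseteq> sets W"
    if "Y \<in> borel_measurable W" "space W = space M" for Y :: "'a \<Rightarrow> complex" and W
    unfolding that(2)[symmetric]
    by (rule sets.sigma_sets_subset) (auto intro: measurable_sets[OF that(1)])
  have indep: "indep_var borel (\<lambda>x. of_bool (N x = n) :: complex) borel (\<lambda>x. iexp (u * S n x))" for n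
    unfolding indep_var_eq
  proof (intro conjI)
    have "(\<lambda>x. of_bool (N x = n) :: complex) \<in> borel_measurable V"
      "(\<lambda>x. iexp (u * S n x)) \<in> borel_measurable G"
      using S_G[of n] by measurable
    from sigma_sub[OF this(1) space_V] sigma_sub[OF this(2) space_G]
    show "indep_set
        (sigma_sets (space M) {(\<lambda>x. of_bool (N x = n) :: complex) -` A \<inter> space M |A. A \<in> sets borel})
        (sigma_sets (space M) {(\<lambda>x. iexp (u * S n x)) -` A \<inter> space M |A. A \<in> sets borel})"
      unfolding indep_set_def
      by (intro indep_sets_mono_sets[OF N_indep[unfolded indep_set_def]])
        (simp add: sets_G sets_V split: bool.splits)
  qed auto
  have term_eq: "(CLINT x|M. of_bool (N x = n) * iexp (u * S n x))
      = (CLINT x|M. of_bool (N x = n) * f ^ n)" for n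
  proof -
    have "(CLINT x|M. of_bool (N x = n) * iexp (u * S n x))
        = (CLINT x|M. of_bool (N x = n)) * (CLINT x|M. iexp (u * S n x))"
    proof (rule indep_var_lebesgue_integral)
      show "indep_var borel (\<lambda>x. of_bool (N x = n) :: complex) borel (\<lambda>x. iexp (u * S n x))"
        by (rule indep)
      show "complex_integrable M (\<lambda>x. of_bool (N x = n))"
        by (intro integrable_const_bound[where B = 1]) auto
      show "complex_integrable M (\<lambda>x. iexp (u * S n x))"
        by (intro integrable_const_bound[where B = 1]) auto
    qed
    also have "(CLINT x|M. iexp (u * S n x)) = f ^ n"
      using char_S[of n] by (simp add: char_def integral_distr)
    finally show ?thesis by simp
  qed
  have "(\<lambda>n. CLINT x|M. of_bool (N x = n) * iexp (u * S n x)) sums (CLINT x|M. iexp (u * S (N x) x))"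
    by (rule sums_expectation_split) auto
  moreover have "(\<lambda>n. CLINT x|M. of_bool (N x = n) * f ^ n) sums (CLINT x|M. f ^ N x)"
    using f_le by (intro sums_expectation_split) auto
  ultimately have "(CLINT x|M. iexp (u * S (N x) x)) = (CLINT x|M. f ^ N x)"
    unfolding term_eq by (rule sums_unique2)
  then show "char (distr M borel (\<lambda>x. \<Sum>i = 1..N x. X i x)) u
      = (CLINT x|M. char (distr M borel (X 1)) u ^ N x)"
    unfolding f_def[symmetric] S_def[symmetric] by (simp add: char_def integral_distr)
qed

text \<open>The expectation is a power series in z with coefficients P(N = n).\<close>

lemma holomorphic_on_expectation_power:
  assumes N [measurable]: "N \<in> measurable M (count_space UNIV)"
  shows "(\<lambda>z. CLINT x|M. z ^ N x) holomorphic_on ball 0 1"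
proof (rule power_series_holomorphic)
  fix w :: complex assume "w \<in> ball 0 1"
  then have "(\<lambda>n. CLINT x|M. of_bool (N x = n) * w ^ n) sums (CLINT x|M. w ^ N x)"
    by (intro sums_expectation_split) (auto simp: norm_power power_le_one)
  then show "(\<lambda>n. (CLINT x|M. of_bool (N x = n)) * (w - 0) ^ n) sums (CLINT x|M. w ^ N x)"
    by simp
qed

end

section \<open>Identification of the generating function on the closed unit disc\<close>

context positive_random_variable
begin

text \<open>Expanding \<open>exp (w Z / t)\<close> shows that \<open>\<phi> ((1 - w) / t)\<close> is the generating function of a mixed
  Poisson law.\<close>

lemma holomorphic_on_laplace_transform_disc:
  assumes "0 < t"
  shows "(\<lambda>w. laplace_transform Q Z ((1 - w) / complex_of_real t)) holomorphic_on ball 0 1"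
proof (rule power_series_holomorphic)
  fix w :: complex assume "w \<in> ball 0 1"
  then have w: "norm w \<le> 1" by simp
  \<comment> \<open>For positive \<open>Z x\<close> these are the weights of the Poisson law with
    mean \<open>Z x / t\<close>; their total mass 1 dominates all partial sums below.\<close>
  define a where "a n x = exp (- (Z x / t)) * ((Z x / t) ^ n / fact n)" for n x
  have [measurable]: "a n \<in> borel_measurable Q" for n
    unfolding a_def by measurable
  have a_sums: "(\<lambda>n. a n x) sums 1" for x
    using sums_mult[OF exp_converges[of "Z x / t"], of "exp (- (Z x / t))"]
    by (simp add: a_def exp_minus divide_inverse mult_ac)
  have a_nonneg: "AE x in Q. \<forall>n. 0 \<le> a n x"
    using Z_pos by eventually_elim (use assms in \<open>simp add: a_def\<close>)
  have partial_le: "AE x in Q. \<forall>m. norm (\<Sum>n<m. complex_of_real (a n x) * w ^ n) \<le> 1"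
    using a_nonneg
  proof eventually_elim
    fix x assume nn: "\<forall>n. 0 \<le> a n x"
    show "\<forall>m. norm (\<Sum>n<m. complex_of_real (a n x) * w ^ n) \<le> 1"
    proof
      fix m
      have "norm (\<Sum>n<m. complex_of_real (a n x) * w ^ n) \<le> (\<Sum>n<m. a n x)"
      proof (rule sum_norm_le)
        show "norm (complex_of_real (a n x) * w ^ n) \<le> a n x" for n
          using w nn by (auto simp: norm_mult norm_power intro!: mult_left_le power_le_one)
      qed
      also have "\<dots> \<le> (\<Sum>n. a n x)"
        using nn a_sums[of x] by (intro sum_le_suminf) (auto simp: sums_iff)
      also have "\<dots> = 1" using a_sums[of x] by (simp add: sums_iff)
      finally show "norm (\<Sum>n<m. complex_of_real (a n x) * w ^ n) \<le> 1" .
    qed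
  qed
  have int: "complex_integrable Q (\<lambda>x. complex_of_real (a n x) * w ^ n)" for n
  proof (rule integrable_const_bound[where B = 1])
    show "AE x in Q. norm (complex_of_real (a n x) * w ^ n) \<le> 1"
      using a_nonneg
    proof eventually_elim
      fix x assume nn: "\<forall>n. 0 \<le> a n x"
      have "norm (complex_of_real (a n x) * w ^ n) \<le> a n x"
        using w nn by (auto simp: norm_mult norm_power intro!: mult_left_le power_le_one)
      also have "\<dots> \<le> (\<Sum>n. a n x)"
        using nn a_sums[of x] sum_le_suminf[of "\<lambda>n. a n x" "{n}"] by (auto simp: sums_iff)
      also have "\<dots> = 1" using a_sums[of x] by (simp add: sums_iff)
      finally show "norm (complex_of_real (a n x) * w ^ n) \<le> 1" .
    qed
  qed auto
  have "(\<lambda>m. CLINT x|Q. (\<Sum>n<m. complex_of_real (a n x) * w ^ n))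
      \<longlonglongrightarrow> (CLINT x|Q. exp (- ((1 - w) / complex_of_real t) * complex_of_real (Z x)))"
  proof (rule integral_dominated_convergence[where w = "\<lambda>_. 1"])
    show "AE x in Q. (\<lambda>m. \<Sum>n<m. complex_of_real (a n x) * w ^ n)
        \<longlonglongrightarrow> exp (- ((1 - w) / complex_of_real t) * complex_of_real (Z x))"
    proof (rule AE_I2)
      fix x
      have "(\<lambda>n. exp (- complex_of_real (Z x / t)) * ((w * complex_of_real (Z x / t)) ^ n /\<^sub>R fact n))
          sums (exp (- complex_of_real (Z x / t)) * exp (w * complex_of_real (Z x / t)))"
        by (intro sums_mult exp_converges)
      also have "exp (- complex_of_real (Z x / t)) * exp (w * complex_of_real (Z x / t))
          = exp (- ((1 - w) / complex_of_real t) * complex_of_real (Z x))"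
        by (simp add: exp_add[symmetric] diff_divide_distrib algebra_simps)
      also have "(\<lambda>n. exp (- complex_of_real (Z x / t)) * ((w * complex_of_real (Z x / t)) ^ n /\<^sub>R fact n))
          = (\<lambda>n. complex_of_real (a n x) * w ^ n)"
        by (auto simp: a_def scaleR_conv_of_real power_mult_distrib exp_of_real[symmetric] divide_inverse
          simp del: exp_of_real)
      finally show "(\<lambda>m. \<Sum>n<m. complex_of_real (a n x) * w ^ n)
        \<longlonglongrightarrow> exp (- ((1 - w) / complex_of_real t) * complex_of_real (Z x))"
        by (simp add: sums_def)
    qed
    show "AE x in Q. norm (\<Sum>n<m. complex_of_real (a n x) * w ^ n) \<le> 1" for m
      using partial_le by eventually_elim auto
  qed auto
  then have "(\<lambda>n. CLINT x|Q. complex_of_real (a n x) * w ^ n)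
      sums laplace_transform Q Z ((1 - w) / complex_of_real t)"
    unfolding laplace_transform_def sums_def using int by simp
  then show "(\<lambda>n. (CLINT x|Q. complex_of_real (a n x)) * (w - 0) ^ n)
      sums laplace_transform Q Z ((1 - w) / complex_of_real t)"
    by simp
qed

text \<open>The identity theorem extends the hypothesis from (0, 1) to the open disc, and a radial
  limit extends it to the closed disc. The boundary matters because characteristic functions reach
  it, for instance at frequency 0.\<close>

lemma expectation_power_eq:
  fixes M :: "'a measure" and N :: "'a \<Rightarrow> nat"
  assumes M: "prob_space M" and N [measurable]: "N \<in> measurable M (count_space UNIV)"
    and k: "1 \<le> k" and t: "0 < t"
    and pgf: "\<And>s. 0 < s \<Longrightarrow> s < 1 \<Longrightarrow> complex_of_real (prob_gen_fun M N s) =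
      complex_of_real (s ^ j) * laplace_transform Q Z (complex_of_real ((1 - s ^ k) / t))"
    and z: "norm z \<le> 1"
  shows "(CLINT x|M. z ^ N x) = z ^ j * laplace_transform Q Z ((1 - z ^ k) / complex_of_real t)"
proof -
  interpret M: prob_space M by fact
  define F where "F z = (CLINT x|M. z ^ N x)" for z
  define H where "H z = z ^ j * laplace_transform Q Z ((1 - z ^ k) / complex_of_real t)" for z
  have F_hol: "F holomorphic_on ball 0 1"
    unfolding F_def by (rule M.holomorphic_on_expectation_power) fact
  have H_hol: "H holomorphic_on ball 0 1"
  proof -
    have "(\<lambda>w. laplace_transform Q Z ((1 - w) / complex_of_real t)) \<circ> (\<lambda>z. z ^ k) holomorphic_on ball 0 1"
      by (rule holomorphic_on_compose_gen[OF _ holomorphic_on_laplace_transform_disc[OF t]])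
        (use k in \<open>auto intro!: holomorphic_intros simp: norm_power power_less_one_iff\<close>)
    then show ?thesis
      unfolding H_def comp_def by (intro holomorphic_intros)
  qed
  have real_eq: "F (complex_of_real s) - H (complex_of_real s) = 0" if "0 < s" "s < 1" for s
  proof -
    have "F (complex_of_real s) = complex_of_real (prob_gen_fun M N s)"
      unfolding F_def prob_gen_fun_def by (simp flip: of_real_power)
    also have "\<dots> = H (complex_of_real s)"
      using pgf[OF that] by (simp add: H_def)
    finally show ?thesis by simp
  qed
  have open_disc: "F w = H w" if "norm w < 1" for w
  proof -
    have "F w - H w = 0"
    proof (rule analytic_continuation[where f = "\<lambda>w. F w - H w" and S = "ball 0 1"
        and U = "complex_of_real ` {0<..<1}" and \<xi> = 0])
      show "0 islimpt complex_of_real ` {0<..<1}"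
        unfolding islimpt_approachable
      proof (intro allI impI)
        fix e :: real assume "0 < e"
        then show "\<exists>x'\<in>complex_of_real ` {0<..<1}. x' \<noteq> 0 \<and> dist x' 0 < e"
          by (intro bexI[of _ "complex_of_real (min (e / 2) (1 / 2))"] conjI imageI)
            (auto simp: min_def)
      qed
    qed (use F_hol H_hol real_eq that in \<open>auto intro!: holomorphic_intros\<close>)
    then show ?thesis by simp
  qed
  \<comment> \<open>These points lie in the open disc even when |z| = 1. Along them the left side
    converges by dominated convergence, the right side by continuity of \<phi> on the closed
    half-plane.\<close>
  define w where "w n = complex_of_real (real n / real (Suc n)) * z" for n
  have w_le: "norm (w n) < 1" for n
  proof -
    have "norm (w n) = real n / real (Suc n) * norm z"
      unfolding w_def norm_mult norm_of_real by simp
    also have "\<dots> \<le> real n / real (Suc n) * 1"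
      using z by (intro mult_left_mono) auto
    also have "\<dots> < 1" by simp
    finally show ?thesis .
  qed
  have "w \<longlonglongrightarrow> complex_of_real 1 * z"
    unfolding w_def using LIMSEQ_n_over_Suc_n by (intro tendsto_intros)
  then have w_lim: "w \<longlonglongrightarrow> z" by simp
  have "(\<lambda>n. F (w n)) \<longlonglongrightarrow> F z"
    unfolding F_def
  proof (rule integral_dominated_convergence[where w = "\<lambda>_. 1"])
    show "AE x in M. norm (w n ^ N x) \<le> 1" for n
      using less_imp_le[OF w_le] by (intro AE_I2) (simp add: norm_power power_le_one)
    show "AE x in M. (\<lambda>n. w n ^ N x) \<longlonglongrightarrow> z ^ N x"
      by (intro AE_I2 tendsto_intros w_lim)
  qed auto
  moreover have "(\<lambda>n. H (w n)) \<longlonglongrightarrow> H z"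
    unfolding H_def
  proof (intro tendsto_intros w_lim continuous_on_tendsto_compose[OF continuous_on_laplace_transform])
    have *: "0 \<le> Re ((1 - y ^ k) / complex_of_real t)" if "norm y \<le> 1" for y
      using that t by (intro Re_one_minus_div_nonneg) (auto simp: norm_power power_le_one)
    show "(1 - z ^ k) / complex_of_real t \<in> {v. 0 \<le> Re v}"
      using *[OF z] by simp
    show "\<forall>\<^sub>F n in sequentially. (1 - w n ^ k) / complex_of_real t \<in> {v. 0 \<le> Re v}"
      using *[OF less_imp_le[OF w_le]] by simp
  qed (use t in auto)
  ultimately have "F z = H z"
    using open_disc[OF w_le] LIMSEQ_unique by simp
  then show ?thesis by (simp add: F_def H_def)
qed

end

section \<open>Compactness and limits of powers\<close>

text \<open>A continuous path from \<open>0\<close> along which \<open>G\<close> stays small cannot cross a circle on which \<open>G\<close>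
  does not vanish.\<close>

lemma norm_less_of_nonvanishing_on_sphere:
  fixes G :: "complex \<Rightarrow> complex"
  assumes A: "closed A" "continuous_on A G" and r: "0 < r"
    and nz: "\<And>v. v \<in> A \<Longrightarrow> norm v = r \<Longrightarrow> G v \<noteq> 0"
  shows "\<exists>c>0. \<forall>d (h :: real \<Rightarrow> complex). continuous_on UNIV h \<longrightarrow> h 0 = 0 \<longrightarrow>
    (\<forall>u. \<bar>u\<bar> \<le> d \<longrightarrow> h u \<in> A \<and> norm (G (h u)) < c) \<longrightarrow> (\<forall>u. \<bar>u\<bar> \<le> d \<longrightarrow> norm (h u) < r)"
proof -
  \<comment> \<open>The witness is the minimum of |G| on the compact part of the circle inside
    \<open>A\<close>; it is chosen before the path, so one c serves all paths. If that part is
    empty, any positive number does.\<close>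
  obtain c where c: "0 < c" "\<And>v. v \<in> A \<Longrightarrow> norm v = r \<Longrightarrow> c \<le> norm (G v)"
  proof (cases "A \<inter> sphere 0 r = {}")
    case True
    then show ?thesis using that[of 1] by (auto simp: disjoint_iff)
  next
    case False
    have "\<exists>v\<in>A \<inter> sphere 0 r. \<forall>w\<in>A \<inter> sphere 0 r. norm (G v) \<le> norm (G w)"
    proof (rule continuous_attains_inf[OF _ False])
      show "compact (A \<inter> sphere 0 r)"
        using A(1) by (intro closed_Int_compact) auto
      show "continuous_on (A \<inter> sphere 0 r) (\<lambda>v. norm (G v))"
        using A(2) by (intro continuous_on_norm) (auto intro: continuous_on_subset)
    qed
    then obtain v where "v \<in> A" "norm v = r" "\<And>w. w \<in> A \<Longrightarrow> norm w = r \<Longrightarrow> norm (G v) \<le> norm (G w)"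
      by auto
    then show ?thesis using that[of "norm (G v)"] nz by auto
  qed
  have "norm (h u) < r"
    if h: "continuous_on UNIV h" "h 0 = 0" "\<forall>u. \<bar>u\<bar> \<le> d \<longrightarrow> h u \<in> A \<and> norm (G (h u)) < c"
      and u: "\<bar>u\<bar> \<le> d" for d u and h :: "real \<Rightarrow> complex"
  proof (rule ccontr)
    assume "\<not> norm (h u) < r"
    moreover have "continuous_on {0..1} (\<lambda>s. norm (h (s * u)))"
      by (intro continuous_on_norm continuous_on_compose2[OF h(1)] continuous_intros) auto
    ultimately obtain s where s: "0 \<le> s" "s \<le> 1" "norm (h (s * u)) = r"
      using IVT'[of "\<lambda>s. norm (h (s * u))" 0 r 1] h(2) r by auto
    have "\<bar>s * u\<bar> \<le> 1 * \<bar>u\<bar>"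
      unfolding abs_mult using s by (intro mult_right_mono) auto
    then have "h (s * u) \<in> A \<and> norm (G (h (s * u))) < c"
      using h(3) u by auto
    then show False using c(2) s(3) by fastforce
  qed
  then show ?thesis using c(1) by blast
qed

text \<open>An Arzela-Ascoli argument: a diagonal subsequence converges at all rationals, and
  equicontinuity carries the Cauchy property to every real and makes the limit continuous. It
  suffices that equicontinuity holds for all large n.\<close>

lemma pointwise_convergent_subsequence:
  fixes g :: "nat \<Rightarrow> real \<Rightarrow> complex"
  assumes bdd: "\<And>u. \<exists>C. \<forall>n. norm (g n u) \<le> C"
    and equi: "\<And>u e. 0 < e \<Longrightarrow>
      \<exists>d>0. \<forall>\<^sub>F n in sequentially. \<forall>h. \<bar>h\<bar> \<le> d \<longrightarrow> norm (g n (u + h) - g n u) < e"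
  shows "\<exists>r G. strict_mono (r :: nat \<Rightarrow> nat) \<and> continuous_on UNIV G \<and> (\<forall>u. (\<lambda>n. g (r n) u) \<longlonglongrightarrow> G u)"
proof -
  obtain C where C: "\<And>u n. norm (g n u) \<le> C u"
    using bdd by metis
  \<comment> \<open>The diagonal argument \<open>function_convergent_subsequence\<close> asks for
    one bound at all points, so \<open>g\<close> is rescaled at each point; \<open>1 + |C u|\<close>
    is never 0.\<close>
  define g' where "g' n u = g n u / complex_of_real (1 + \<bar>C u\<bar>)" for n u
  have "norm (g' n u) \<le> 1" for n u
    using C[of n u] unfolding g'_def norm_divide norm_of_real by simp
  then obtain r where r: "strict_mono (r :: nat \<Rightarrow> nat)"
    and lim: "\<And>q. q \<in> \<rat> \<Longrightarrow> \<exists>l. (\<lambda>n. g' (r n) q) \<longlonglongrightarrow> l"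
    using function_convergent_subsequence[OF countable_rat, of g' 1] by metis
  have conv_rat: "convergent (\<lambda>n. g (r n) q)" if "q \<in> \<rat>" for q
  proof -
    obtain l where "(\<lambda>n. g' (r n) q) \<longlonglongrightarrow> l" using lim[OF \<open>q \<in> \<rat>\<close>] by blast
    then have "(\<lambda>n. g' (r n) q * complex_of_real (1 + \<bar>C q\<bar>)) \<longlonglongrightarrow> l * complex_of_real (1 + \<bar>C q\<bar>)"
      by (intro tendsto_intros)
    moreover have "complex_of_real (1 + \<bar>C q\<bar>) \<noteq> 0"
      unfolding of_real_eq_0_iff by linarith
    ultimately show ?thesis
      by (auto simp: g'_def convergent_def)
  qed
  have equi_r: "\<exists>d>0. \<forall>\<^sub>F n in sequentially. \<forall>h. \<bar>h\<bar> \<le> d \<longrightarrow> norm (g (r n) (u + h) - g (r n) u) < e"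
    if "0 < e" for u e
    using equi[OF that, of u] eventually_subseq[OF r] by fast
  have "Cauchy (\<lambda>n. g (r n) u)" for u
  proof (rule metric_CauchyI)
    fix e :: real assume "0 < e"
    then obtain d where d: "d > 0"
      "\<forall>\<^sub>F n in sequentially. \<forall>h. \<bar>h\<bar> \<le> d \<longrightarrow> norm (g (r n) (u + h) - g (r n) u) < e / 3"
      using equi_r[of "e / 3" u] by auto
    obtain q where q: "q \<in> \<rat>" "u < q" "q < u + d"
      using Rats_dense_in_real[of u "u + d"] d(1) by auto
    have "\<forall>\<^sub>F n in sequentially. norm (g (r n) q - g (r n) u) < e / 3"
      using d(2) by eventually_elim (use q in \<open>auto dest!: spec[of _ "q - u"]\<close>)
    then obtain n1 where n1: "\<And>n. n \<ge> n1 \<Longrightarrow> dist (g (r n) q) (g (r n) u) < e / 3"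
      unfolding eventually_sequentially dist_norm by blast
    obtain n2 where n2: "\<And>m n. m \<ge> n2 \<Longrightarrow> n \<ge> n2 \<Longrightarrow> dist (g (r m) q) (g (r n) q) < e / 3"
      using conv_rat[OF q(1)] \<open>0 < e\<close> unfolding Cauchy_convergent_iff[symmetric] Cauchy_def
      by (metis divide_pos_pos zero_less_numeral)
    have "dist (g (r m) u) (g (r n) u) < e" if "m \<ge> max n1 n2" "n \<ge> max n1 n2" for m n
      using n1[of m] n1[of n] n2[of m n] that
        dist_triangle[of "g (r m) u" "g (r n) u" "g (r m) q"]
        dist_triangle[of "g (r m) q" "g (r n) u" "g (r n) q"]
      by (simp add: dist_commute)
    then show "\<exists>K. \<forall>m\<ge>K. \<forall>n\<ge>K. dist (g (r m) u) (g (r n) u) < e" by blast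
  qed
  then have "\<forall>u. \<exists>l. (\<lambda>n. g (r n) u) \<longlonglongrightarrow> l"
    by (simp add: Cauchy_convergent_iff convergent_def)
  then obtain G where G: "\<And>u. (\<lambda>n. g (r n) u) \<longlonglongrightarrow> G u" by metis
  have "isCont G u" for u
    unfolding continuous_at_eps_delta
  proof (intro allI impI)
    fix e :: real assume "0 < e"
    then obtain d where d: "d > 0"
      "\<forall>\<^sub>F n in sequentially. \<forall>h. \<bar>h\<bar> \<le> d \<longrightarrow> norm (g (r n) (u + h) - g (r n) u) < e / 2"
      using equi_r[of "e / 2" u] by auto
    have "dist (G x) (G u) < e" if "dist x u < d" for x
    proof -
      have "norm (G x - G u) \<le> e / 2"
      proof (rule tendsto_upperbound)
        show "(\<lambda>n. norm (g (r n) x - g (r n) u)) \<longlonglongrightarrow> norm (G x - G u)"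
          by (intro tendsto_intros G)
        show "\<forall>\<^sub>F n in sequentially. norm (g (r n) x - g (r n) u) \<le> e / 2"
          using d(2) by eventually_elim
            (use that in \<open>auto simp: dist_real_def intro: less_imp_le dest!: spec[of _ "x - u"]\<close>)
      qed simp
      then show ?thesis using \<open>0 < e\<close> by (simp add: dist_norm)
    qed
    then show "\<exists>d>0. \<forall>x'. dist x' u < d \<longrightarrow> dist (G x') (G u) < e"
      using d(1) by blast
  qed
  then show ?thesis
    using r G by (auto intro!: exI[of _ r] exI[of _ G] continuous_at_imp_continuous_on)
qed

text \<open>With z = t x, both \<open>1 - z\<close> and \<open>exp (- z)\<close> lie in the unit
  disc, so their m-th powers differ by at most m times their distance, which is of order
  \<open>|z|\<^sup>2\<close>. Since m t \<le> s, the product is of order \<open>s |x| |z|\<close>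
  and tends to 0.\<close>

lemma power_floor_tendsto_exp:
  fixes x :: "nat \<Rightarrow> complex" and t :: "nat \<Rightarrow> real"
  assumes t: "\<And>n. 0 < t n" "t \<longlonglongrightarrow> 0" and s: "0 < s"
    and x: "x \<longlonglongrightarrow> y" "\<And>n. 0 \<le> Re (x n)"
    and le1: "\<And>n. norm (1 - complex_of_real (t n) * x n) \<le> 1"
  shows "(\<lambda>n. (1 - complex_of_real (t n) * x n) ^ nat \<lfloor>s / t n\<rfloor>) \<longlonglongrightarrow> exp (- (complex_of_real s * y))"
proof -
  define m where "m n = nat \<lfloor>s / t n\<rfloor>" for n
  define z where "z n = complex_of_real (t n) * x n" for n
  have m_le: "real (m n) * t n \<le> s" and m_ge: "s - t n \<le> real (m n) * t n" for n
  proof -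
    have "0 \<le> s / t n" using s t(1)[of n] by simp
    then have "real (m n) \<le> s / t n" "s / t n - 1 \<le> real (m n)"
      unfolding m_def by linarith+
    then show "real (m n) * t n \<le> s" "s - t n \<le> real (m n) * t n"
      using t(1)[of n] by (auto simp: field_simps)
  qed
  have mt: "(\<lambda>n. real (m n) * t n) \<longlonglongrightarrow> s"
  proof (rule tendsto_sandwich)
    show "(\<lambda>n. s - t n) \<longlonglongrightarrow> s" using tendsto_diff[OF tendsto_const t(2), of s] by simp
    show "(\<lambda>n. s) \<longlonglongrightarrow> s" by simp
  qed (use m_le m_ge in auto)
  have z0: "z \<longlonglongrightarrow> 0"
    unfolding z_def using tendsto_mult[OF tendsto_of_real[OF t(2)] x(1)] by simp
  have "(\<lambda>n. (1 - z n) ^ m n - exp (- z n) ^ m n) \<longlonglongrightarrow> 0"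
  proof (rule Lim_null_comparison)
    show "(\<lambda>n. s * norm (x n) * (exp (norm (z n)) * norm (z n))) \<longlonglongrightarrow> 0"
      using tendsto_mult[OF tendsto_mult[OF tendsto_const tendsto_norm[OF x(1)]]
          tendsto_mult[OF tendsto_exp[OF tendsto_norm[OF z0]] tendsto_norm[OF z0]], of s]
      by simp
    show "\<forall>\<^sub>F n in sequentially. norm ((1 - z n) ^ m n - exp (- z n) ^ m n)
        \<le> s * norm (x n) * (exp (norm (z n)) * norm (z n))"
    proof (rule always_eventually, rule allI)
      fix n
      have "norm ((1 - z n) ^ m n - exp (- z n) ^ m n) \<le> m n * norm ((1 - z n) - exp (- z n))"
        using le1[of n] t(1)[of n] x(2)[of n] by (intro norm_power_diff) (auto simp: z_def)
      also have "norm ((1 - z n) - exp (- z n)) \<le> exp \<bar>Re (- z n)\<bar> * norm (- z n) ^ Suc 1 / fact 1"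
        using Taylor_exp[of "- z n" 1] by (simp add: norm_minus_commute)
      also have "\<dots> \<le> exp (norm (z n)) * (norm (z n))\<^sup>2"
        using abs_Re_le_cmod[of "z n"] by (simp add: power2_eq_square mult_right_mono)
      also have "m n * (exp (norm (z n)) * (norm (z n))\<^sup>2)
          = (real (m n) * t n) * norm (x n) * (exp (norm (z n)) * norm (z n))"
        using t(1)[of n] by (simp add: z_def norm_mult power2_eq_square)
      also have "\<dots> \<le> s * norm (x n) * (exp (norm (z n)) * norm (z n))"
        by (intro mult_right_mono m_le) auto
      finally show "norm ((1 - z n) ^ m n - exp (- z n) ^ m n)
          \<le> s * norm (x n) * (exp (norm (z n)) * norm (z n))"
        by (simp add: mult_left_mono)
    qed
  qed
  moreover have "(\<lambda>n. exp (- z n) ^ m n) \<longlonglongrightarrow> exp (- (complex_of_real s * y))"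
  proof -
    have "(\<lambda>n. exp (- (complex_of_real (real (m n) * t n) * x n))) \<longlonglongrightarrow> exp (- (complex_of_real s * y))"
      by (intro tendsto_intros mt x)
    then show ?thesis
      by (simp add: z_def exp_of_nat_mult[symmetric] mult_ac)
  qed
  ultimately have "(\<lambda>n. (1 - z n) ^ m n) \<longlonglongrightarrow> exp (- (complex_of_real s * y))"
    using Lim_transform by fastforce
  then show ?thesis by (simp add: z_def m_def)
qed

section \<open>Limits of random sums\<close>

text \<open>There are only finitely many roots of unity of order k. This allows the passage from
  \<open>f ^ k\<close> near 1 to f near 1.\<close>

lemma roots_of_unity_isolated:
  assumes "1 \<le> k"
  shows "\<exists>r>0. \<forall>v::complex. v \<noteq> 0 \<longrightarrow> norm v < r \<longrightarrow> (1 - v) ^ k \<noteq> 1"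
proof -
  have "finite {z::complex. z ^ k = 1}"
    using assms by (intro finite_roots_unity) auto
  then obtain r where "r > 0" "\<forall>x\<in>{z::complex. z ^ k = 1}. x \<noteq> 1 \<longrightarrow> r \<le> dist 1 x"
    using finite_set_avoid by blast
  then show ?thesis
    by (intro exI[of _ r]) (force simp: dist_norm)
qed

text \<open>Expand \<open>|1 - z|\<^sup>2 = 1 - 2 Re z + |z|\<^sup>2\<close>. A bound on the real
  part alone thus controls the modulus.\<close>

lemma norm_one_minus_le_Re:
  assumes "norm (z::complex) \<le> 1"
  shows "(norm (1 - z))\<^sup>2 \<le> 2 * Re (1 - z)"
proof -
  have "(Re z)\<^sup>2 + (Im z)\<^sup>2 \<le> 1"
    using assms by (simp add: cmod_def)
  then show ?thesis
    unfolding cmod_power2 by (simp add: power2_eq_square algebra_simps)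
qed

context positive_random_variable
begin

text \<open>In the application \<open>\<mu> n\<close> is the law of a summand and
  \<open>\<Lambda> n\<close> that of the random sum, while \<open>pow\<close> records that sums with
  a fixed number of terms have laws.\<close>

theorem limit_is_mixture:
  fixes \<mu> \<Lambda> :: "nat \<Rightarrow> real measure" and t :: "nat \<Rightarrow> real"
  assumes \<mu>: "\<And>n. real_distribution (\<mu> n)"
    and pow: "\<And>n m. char_fun (\<lambda>u. char (\<mu> n) u ^ m)"
    and t: "\<And>n. 0 < t n" "t \<longlonglongrightarrow> 0" and k: "1 \<le> k"
    and \<Lambda>: "\<And>n. real_distribution (\<Lambda> n)"
    and char_\<Lambda>: "\<And>n u. char (\<Lambda> n) u = char (\<mu> n) u ^ j *
      laplace_transform Q Z ((1 - char (\<mu> n) u ^ k) / complex_of_real (t n))"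
    and L: "real_distribution L" and conv: "weak_conv_m \<Lambda> L"
  shows "\<exists>\<omega>. inf_div_char_fun \<omega> \<and> (\<forall>u. char L u = laplace_transform Q Z (- char_log \<omega> u))"
proof -
  interpret \<mu>: real_distribution "\<mu> n" for n by (rule \<mu>)
  define f where "f n = char (\<mu> n)" for n
  define g where "g n u = (1 - f n u ^ k) / complex_of_real (t n)" for n u
  \<comment> \<open>Through the laws \<open>\<nu> n\<close>, the function \<open>g n\<close> becomes
    \<open>1 - char\<close> divided by \<open>t n\<close>, so the inequalities for characteristic
    functions apply to it.\<close>
  obtain \<nu> where \<nu>: "\<And>n. real_distribution (\<nu> n)" "\<And>n u. char (\<nu> n) u = f n u ^ k"
    using pow[of _ k] unfolding char_fun_def f_def fun_eq_iff by metis
  interpret \<nu>: real_distribution "\<nu> n" for n by (rule \<nu>)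
  have g_\<nu>: "g n u = (1 - char (\<nu> n) u) / complex_of_real (t n)" for n u
    by (simp add: g_def \<nu>)
  have norm_g: "norm (g n u) = norm (1 - char (\<nu> n) u) / t n" for n u
    using t(1)[of n] by (simp add: g_\<nu> norm_divide)
  have f_le: "norm (f n u) \<le> 1" for n u
    unfolding f_def by (rule \<mu>.cmod_char_le_1)
  have fk_le: "norm (f n u ^ i) \<le> 1" for n u i
    using f_le by (simp add: norm_power power_le_one)
  have Re_g: "0 \<le> Re (g n u)" for n u
    unfolding g_def using fk_le t(1) by (rule Re_one_minus_div_nonneg)
  have cont_f: "continuous_on UNIV (f n)" for n
    unfolding f_def by (intro continuous_at_imp_continuous_on ballI \<mu>.isCont_char)
  have cont_g: "continuous_on UNIV (g n)" for n
    unfolding g_def using cont_f t(1)[of n] by (intro continuous_intros) auto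
  have f0: "f n 0 = 1" and g0: "g n 0 = 0" for n
    by (simp_all add: f_def g_def \<mu>.char_zero)
  have f_g: "1 - f n u ^ k = complex_of_real (t n) * g n u" for n u
    using t(1)[of n] by (simp add: g_def)
  have \<Lambda>_eq: "char (\<Lambda> n) u = f n u ^ j * laplace_transform Q Z (g n u)" for n u
    by (simp add: char_\<Lambda> f_def g_def)
  have \<phi>_le: "norm (laplace_transform Q Z (g n u)) \<le> 1" for n u
    by (rule norm_laplace_transform_le_1[OF Re_g])
  have near: "\<exists>d>0. \<forall>\<^sub>F n in sequentially. \<forall>u. \<bar>u\<bar> \<le> d \<longrightarrow> norm (1 - char (\<Lambda> n) u) < e"
    if "0 < e" for e
    by (rule weak_conv_m_char_near_0[OF \<Lambda> L conv that])

  \<comment> \<open>Uniform convergence of \<open>f n\<close> to 1 near 0\<close>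
  obtain d1 where d1: "d1 > 0"
    "\<forall>\<^sub>F n in sequentially. \<forall>u. \<bar>u\<bar> \<le> d1 \<longrightarrow> norm (1 - char (\<Lambda> n) u) < 1 / 2"
    using near[of "1 / 2"] by auto
  have f_near: "\<forall>\<^sub>F n in sequentially. \<forall>u. \<bar>u\<bar> \<le> d1 \<longrightarrow> norm (1 - f n u) < e" if "0 < e" for e
  proof -
    obtain B where B: "\<And>v. 0 \<le> Re v \<Longrightarrow> 1 / 2 \<le> norm (laplace_transform Q Z v) \<Longrightarrow> Re v \<le> B"
      using laplace_transform_ge_half_imp_bounded by blast
    obtain r where r: "r > 0" "\<And>v::complex. v \<noteq> 0 \<Longrightarrow> norm v < r \<Longrightarrow> (1 - v) ^ k \<noteq> 1"
      using roots_of_unity_isolated[OF k] by blast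
    \<comment> \<open>The isolation of 1 among the roots of unity holds strictly inside radius r,
      hence the half.\<close>
    define \<rho> where "\<rho> = min e (r / 2)"
    have \<rho>: "0 < \<rho>" "\<rho> < r" "\<rho> \<le> e" using r(1) that by (auto simp: \<rho>_def)
    obtain c where c: "c > 0" "\<And>d (h :: real \<Rightarrow> complex). continuous_on UNIV h \<Longrightarrow> h 0 = 0 \<Longrightarrow>
        (\<forall>u. \<bar>u\<bar> \<le> d \<longrightarrow> h u \<in> UNIV \<and> norm (1 - (1 - h u) ^ k) < c) \<Longrightarrow> (\<forall>u. \<bar>u\<bar> \<le> d \<longrightarrow> norm (h u) < \<rho>)"
      using norm_less_of_nonvanishing_on_sphere[of UNIV "\<lambda>v. 1 - (1 - v) ^ k" \<rho>] r \<rho>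
      by (fastforce intro!: continuous_intros)
    have "(\<lambda>n. 2 * (B * t n)) \<longlonglongrightarrow> 2 * (B * 0)"
      by (intro tendsto_intros t)
    then have "\<forall>\<^sub>F n in sequentially. 2 * (B * t n) < c\<^sup>2"
      by (rule order_tendstoD) (use c(1) in simp)
    with d1(2) show ?thesis
    proof eventually_elim
      fix n assume n: "\<forall>u. \<bar>u\<bar> \<le> d1 \<longrightarrow> norm (1 - char (\<Lambda> n) u) < 1 / 2" "2 * (B * t n) < c\<^sup>2"
      have "norm (1 - f n u ^ k) < c" if "\<bar>u\<bar> \<le> d1" for u
      proof -
        \<comment> \<open>As \<open>f n u ^ j\<close> has modulus at most 1, the bound 1 / 2 passes
          to \<phi> and gives \<open>Re (g n u) \<le> B\<close>. Multiplying by \<open>t n\<close>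
          bounds \<open>Re (1 - f n u ^ k)\<close>, and then
          \<open>|1 - f n u ^ k|\<^sup>2 \<le> 2 B t n\<close>.\<close>
        have "1 / 2 \<le> norm (char (\<Lambda> n) u)"
          using n(1) that norm_triangle_ineq2[of 1 "char (\<Lambda> n) u"] by fastforce
        also have "\<dots> \<le> norm (laplace_transform Q Z (g n u))"
          unfolding \<Lambda>_eq norm_mult using fk_le by (intro mult_left_le_one_le) auto
        finally have "Re (g n u) \<le> B" using B Re_g by blast
        then have "Re (1 - f n u ^ k) \<le> B * t n"
          unfolding f_g using t(1)[of n] by simp
        then have "(norm (1 - f n u ^ k))\<^sup>2 < c\<^sup>2"
          using norm_one_minus_le_Re[OF fk_le, of n u k] n(2) by linarith
        then show ?thesis using c(1) by (simp add: power_less_imp_less_base)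
      qed
      \<comment> \<open>The continuous path \<open>1 - f n\<close> starts at 0, so
        \<open>f n\<close> cannot move over to another root of unity.\<close>
      then have "\<forall>u. \<bar>u\<bar> \<le> d1 \<longrightarrow> norm (1 - f n u) < \<rho>"
        using cont_f f0 by (intro c(2)) (auto intro!: continuous_intros)
      then show "\<forall>u. \<bar>u\<bar> \<le> d1 \<longrightarrow> norm (1 - f n u) < e"
        using \<rho> by fastforce
    qed
  qed

  \<comment> \<open>Uniform smallness of \<open>g n\<close> near 0\<close>
  have g_near: "\<exists>d>0. \<forall>\<^sub>F n in sequentially. \<forall>u. \<bar>u\<bar> \<le> d \<longrightarrow> norm (g n u) < e" if "0 < e" for e
  proof -
    obtain r where r: "r > 0"
      "\<And>v. 0 \<le> Re v \<Longrightarrow> v \<noteq> 0 \<Longrightarrow> norm v \<le> r \<Longrightarrow> laplace_transform Q Z v \<noteq> 1"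
      using laplace_transform_neq_1_near_0 by blast
    define \<rho> where "\<rho> = min e r"
    have \<rho>: "0 < \<rho>" "\<rho> \<le> r" "\<rho> \<le> e" using r(1) that by (auto simp: \<rho>_def)
    have "\<exists>c>0. \<forall>d (h :: real \<Rightarrow> complex). continuous_on UNIV h \<longrightarrow> h 0 = 0 \<longrightarrow>
        (\<forall>u. \<bar>u\<bar> \<le> d \<longrightarrow> h u \<in> {v. 0 \<le> Re v} \<and> norm (1 - laplace_transform Q Z (h u)) < c) \<longrightarrow>
        (\<forall>u. \<bar>u\<bar> \<le> d \<longrightarrow> norm (h u) < \<rho>)"
    proof (rule norm_less_of_nonvanishing_on_sphere)
      show "closed {v. 0 \<le> Re v}" by (rule closed_halfspace_Re_ge)
      show "1 - laplace_transform Q Z v \<noteq> 0" if "v \<in> {v. 0 \<le> Re v}" "norm v = \<rho>" for v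
        using r(2)[of v] that \<rho> by auto
    qed (use \<rho> in \<open>auto intro!: continuous_intros continuous_on_laplace_transform\<close>)
    then obtain c where c: "c > 0" "\<And>d (h :: real \<Rightarrow> complex). continuous_on UNIV h \<Longrightarrow> h 0 = 0 \<Longrightarrow>
        (\<forall>u. \<bar>u\<bar> \<le> d \<longrightarrow> h u \<in> {v. 0 \<le> Re v} \<and> norm (1 - laplace_transform Q Z (h u)) < c) \<Longrightarrow>
        (\<forall>u. \<bar>u\<bar> \<le> d \<longrightarrow> norm (h u) < \<rho>)"
      by blast
    obtain d2 where d2: "d2 > 0"
      "\<forall>\<^sub>F n in sequentially. \<forall>u. \<bar>u\<bar> \<le> d2 \<longrightarrow> norm (1 - char (\<Lambda> n) u) < c / 2"
      using near[of "c / 2"] c(1) by auto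
    \<comment> \<open>The summand 1 keeps the tolerance positive when j = 0.\<close>
    have "0 < c / 2 / (real j + 1)" using c(1) by simp
    from d2(2) f_near[OF this]
    have "\<forall>\<^sub>F n in sequentially. \<forall>u. \<bar>u\<bar> \<le> min d1 d2 \<longrightarrow> norm (g n u) < e"
    proof eventually_elim
      fix n assume n: "\<forall>u. \<bar>u\<bar> \<le> d2 \<longrightarrow> norm (1 - char (\<Lambda> n) u) < c / 2"
        "\<forall>u. \<bar>u\<bar> \<le> d1 \<longrightarrow> norm (1 - f n u) < c / 2 / (real j + 1)"
      have "norm (1 - laplace_transform Q Z (g n u)) < c" if u: "\<bar>u\<bar> \<le> min d1 d2" for u
      proof -
        have "norm (1 - f n u ^ j) \<le> real j * norm (1 - f n u)"
          using norm_power_diff[of 1 "f n u" j] f_le by simp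
        also have "\<dots> \<le> (real j + 1) * norm (1 - f n u)"
          by (intro mult_right_mono) auto
        also have "\<dots> < c / 2"
          using n(2) u by (simp add: pos_less_divide_eq algebra_simps)
        finally have 1: "norm (1 - f n u ^ j) < c / 2" .
        \<comment> \<open>The deviation of \<phi> from 1 is split into that of the random sum and
          that of the factor \<open>f n u ^ j\<close>, each below c / 2.\<close>
        have "norm (1 - laplace_transform Q Z (g n u))
            = norm ((1 - char (\<Lambda> n) u) - (1 - f n u ^ j) * laplace_transform Q Z (g n u))"
          by (simp add: \<Lambda>_eq algebra_simps)
        also have "\<dots> \<le> norm (1 - char (\<Lambda> n) u) + norm ((1 - f n u ^ j) * laplace_transform Q Z (g n u))"
          by (rule norm_triangle_ineq4)
        also have "norm ((1 - f n u ^ j) * laplace_transform Q Z (g n u)) \<le> norm (1 - f n u ^ j)"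
          unfolding norm_mult using \<phi>_le by (intro mult_left_le) auto
        finally have 2: "norm (1 - laplace_transform Q Z (g n u))
            \<le> norm (1 - char (\<Lambda> n) u) + norm (1 - f n u ^ j)" by simp
        have "norm (1 - char (\<Lambda> n) u) < c / 2" using n(1) u by simp
        then show ?thesis using 1 2 by simp
      qed
      then have "\<forall>u. \<bar>u\<bar> \<le> min d1 d2 \<longrightarrow> norm (g n u) < \<rho>"
        using cont_g g0 Re_g by (intro c(2)) auto
      then show "\<forall>u. \<bar>u\<bar> \<le> min d1 d2 \<longrightarrow> norm (g n u) < e"
        using \<rho> by fastforce
    qed
    then show ?thesis using d1(1) d2(1) by (intro exI[of _ "min d1 d2"]) auto
  qed

  \<comment> \<open>From a neighbourhood of 0 to the whole line\<close>
  have small_multiple: "\<exists>m::nat. \<exists>v. u = real m * v \<and> \<bar>v\<bar> \<le> d" if "0 < d" for u d :: real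
  proof -
    obtain m :: nat where m: "\<bar>u\<bar> / d < real m" using reals_Archimedean2 by blast
    moreover have "0 \<le> \<bar>u\<bar> / d" using that by simp
    ultimately have "0 < real m" by linarith
    then show ?thesis
      using m that by (intro exI[of _ m] exI[of _ "u / real m"]) (auto simp: field_simps)
  qed

  have f_lim: "(\<lambda>n. f n u) \<longlonglongrightarrow> 1" for u
  proof -
    obtain m v where mv: "u = real m * v" "\<bar>v\<bar> \<le> d1"
      using small_multiple[OF d1(1)] by blast
    have "(\<lambda>n. 1 - f n v) \<longlonglongrightarrow> 0"
      unfolding tendsto_iff dist_0_norm[symmetric]
    proof (intro allI impI)
      fix e :: real assume "0 < e"
      from f_near[OF this] show "\<forall>\<^sub>F n in sequentially. dist (1 - f n v) 0 < e"
        by eventually_elim (use mv in auto)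
    qed
    then have "(\<lambda>n. (real m)\<^sup>2 * norm (1 - f n v)) \<longlonglongrightarrow> 0"
      by (intro tendsto_mult_right_zero tendsto_norm_zero)
    then have "(\<lambda>n. 1 - f n u) \<longlonglongrightarrow> 0"
      by (rule Lim_null_comparison[rotated])
        (auto simp: mv f_def intro!: always_eventually \<mu>.norm_one_minus_char_mult)
    from tendsto_diff[OF tendsto_const this, of 1] show ?thesis by simp
  qed

  have g_bdd: "\<exists>C. \<forall>n. norm (g n u) \<le> C" for u
  proof -
    obtain d where d: "d > 0" "\<forall>\<^sub>F n in sequentially. \<forall>u. \<bar>u\<bar> \<le> d \<longrightarrow> norm (g n u) < 1"
      using g_near[of 1] by auto
    obtain m v where mv: "u = real m * v" "\<bar>v\<bar> \<le> d"
      using small_multiple[OF d(1)] by blast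
    have "\<forall>\<^sub>F n in sequentially. norm (g n u) \<le> (real m)\<^sup>2"
      using d(2)
    proof eventually_elim
      fix n assume "\<forall>u. \<bar>u\<bar> \<le> d \<longrightarrow> norm (g n u) < 1"
      then have "norm (g n v) \<le> 1" using mv(2) by (simp add: less_imp_le)
      have "norm (g n u) \<le> (real m)\<^sup>2 * norm (1 - char (\<nu> n) v) / t n"
        unfolding norm_g mv(1) using t(1)[of n]
        by (intro divide_right_mono \<nu>.norm_one_minus_char_mult) auto
      also have "\<dots> = (real m)\<^sup>2 * norm (g n v)"
        by (simp add: norm_g)
      also have "\<dots> \<le> (real m)\<^sup>2"
        using \<open>norm (g n v) \<le> 1\<close> by (intro mult_left_le) auto
      finally show "norm (g n u) \<le> (real m)\<^sup>2" .
    qed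
    \<comment> \<open>The bound is known for large n only; the finitely many other values do not
      affect boundedness.\<close>
    then have "Bseq (\<lambda>n. g n u)"
      by (rule BfunI)
    then show ?thesis by (auto simp: Bseq_def)
  qed

  \<comment> \<open>The bound in \<open>char_increment\<close> scales linearly when both values are
    scaled together, so dividing by \<open>t n\<close> replaces \<open>1 - char\<close> by
    \<open>g n\<close> throughout.\<close>
  have g_increment: "norm (g n (u + h) - g n u) \<le> norm (g n h) + 2 * sqrt (norm (g n u) * norm (g n h))"
    for n u h
  proof -
    have "norm (g n (u + h) - g n u - g n h)
        = norm ((1 - char (\<nu> n) (u + h)) - (1 - char (\<nu> n) u) - (1 - char (\<nu> n) h)) / t n"
      using t(1)[of n] by (simp add: g_\<nu> norm_divide flip: diff_divide_distrib)
    also have "\<dots> \<le> 2 * sqrt (norm (1 - char (\<nu> n) u) * norm (1 - char (\<nu> n) h)) / t n"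
      using t(1)[of n] by (intro divide_right_mono \<nu>.char_increment) auto
    also have "\<dots> = 2 * sqrt (norm (g n u) * norm (g n h))"
      using t(1)[of n] by (simp add: norm_g real_sqrt_divide)
    finally show ?thesis
      using norm_triangle_sub[of "g n (u + h) - g n u" "g n h"] by linarith
  qed

  have g_equi: "\<exists>d>0. \<forall>\<^sub>F n in sequentially. \<forall>h. \<bar>h\<bar> \<le> d \<longrightarrow> norm (g n (u + h) - g n u) < e"
    if "0 < e" for u e
  proof -
    obtain C where C: "\<And>n. norm (g n u) \<le> C" using g_bdd by blast
    have "C \<ge> 0" using C norm_ge_zero order_trans by blast
    \<comment> \<open>By \<open>g_increment\<close>, \<open>|g n h| \<le> y\<close> makes the
      increment at u at most \<open>y + 2 sqrt (C y)\<close>; y is chosen to bring this below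
      e.\<close>
    have "((\<lambda>y. y + 2 * sqrt (C * y)) \<longlongrightarrow> 0 + 2 * sqrt (C * 0)) (at_right 0)"
      by (intro tendsto_intros)
    then have "\<forall>\<^sub>F y in at_right 0. y + 2 * sqrt (C * y) < e"
      using \<open>0 < e\<close> by (intro order_tendstoD) auto
    then have "\<forall>\<^sub>F y in at_right 0. y + 2 * sqrt (C * y) < e \<and> 0 < y"
      using eventually_at_right_less[of "0::real"] by eventually_elim simp
    then obtain y where y: "y + 2 * sqrt (C * y) < e" "0 < y"
      using eventually_happens[of _ "at_right (0::real)"] by auto
    obtain d where d: "d > 0" "\<forall>\<^sub>F n in sequentially. \<forall>u. \<bar>u\<bar> \<le> d \<longrightarrow> norm (g n u) < y"
      using g_near[OF y(2)] by auto
    have "\<forall>\<^sub>F n in sequentially. \<forall>h. \<bar>h\<bar> \<le> d \<longrightarrow> norm (g n (u + h) - g n u) < e"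
      using d(2)
    proof eventually_elim
      fix n assume n: "\<forall>u. \<bar>u\<bar> \<le> d \<longrightarrow> norm (g n u) < y"
      show "\<forall>h. \<bar>h\<bar> \<le> d \<longrightarrow> norm (g n (u + h) - g n u) < e"
      proof (intro allI impI)
        fix h assume "\<bar>h\<bar> \<le> d"
        then have h: "norm (g n h) \<le> y" using n by (simp add: less_imp_le)
        have "norm (g n (u + h) - g n u) \<le> norm (g n h) + 2 * sqrt (norm (g n u) * norm (g n h))"
          by (rule g_increment)
        also have "\<dots> \<le> y + 2 * sqrt (C * y)"
          using h C[of n] \<open>C \<ge> 0\<close>
          by (intro add_mono mult_left_mono real_sqrt_le_mono mult_mono) auto
        finally show "norm (g n (u + h) - g n u) < e" using y(1) by simp
      qed
    qed
    then show ?thesis using d(1) by blast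
  qed

  \<comment> \<open>The limit along a subsequence\<close>
  obtain r G where r: "strict_mono (r :: nat \<Rightarrow> nat)" and G: "continuous_on UNIV G"
    and lim: "\<And>u. (\<lambda>n. g (r n) u) \<longlonglongrightarrow> G u"
    using pointwise_convergent_subsequence[OF g_bdd g_equi] by auto
  have G0: "G 0 = 0"
    using LIMSEQ_unique[OF lim[of 0]] by (simp add: g0)
  have Re_G: "0 \<le> Re (G u)" for u
    by (rule tendsto_lowerbound[OF tendsto_Re[OF lim[of u]]]) (use Re_g in auto)
  have tr: "(\<lambda>n. t (r n)) \<longlonglongrightarrow> 0"
    using LIMSEQ_subseq_LIMSEQ[OF t(2) r] by (simp add: comp_def)
  have powers: "char_fun (\<lambda>u. exp (- (complex_of_real s * G u)))" if "0 < s" for s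
  proof -
    \<comment> \<open>The factor k makes \<open>f ^ m\<close> a power of
      \<open>f ^ k = 1 - t g\<close> with exponent the floor of \<open>s / t\<close>, whose limit is
      \<open>exp (- s G)\<close>.\<close>
    define m where "m n = k * nat \<lfloor>s / t (r n)\<rfloor>" for n
    have "\<forall>n. \<exists>M. real_distribution M \<and> (\<forall>u. char M u = f (r n) u ^ m n)"
      using pow unfolding char_fun_def f_def fun_eq_iff by simp
    then obtain \<kappa> where \<kappa>: "\<And>n. real_distribution (\<kappa> n)" "\<And>n u. char (\<kappa> n) u = f (r n) u ^ m n"
      by metis
    show ?thesis
    proof (rule levy_continuity_char_fun[OF \<kappa>(1)])
      fix u
      have 1: "1 - complex_of_real (t (r n)) * g (r n) u = f (r n) u ^ k" for n
        using f_g[of "r n" u] by (simp add: algebra_simps)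
      have "(\<lambda>n. (1 - complex_of_real (t (r n)) * g (r n) u) ^ nat \<lfloor>s / t (r n)\<rfloor>)
          \<longlonglongrightarrow> exp (- (complex_of_real s * G u))"
        by (rule power_floor_tendsto_exp) (use t(1) tr that lim Re_g fk_le in \<open>auto simp: 1\<close>)
      then show "(\<lambda>n. char (\<kappa> n) u) \<longlonglongrightarrow> exp (- (complex_of_real s * G u))"
        by (simp add: 1 \<kappa> m_def power_mult)
      show "isCont (\<lambda>u. exp (- (complex_of_real s * G u))) 0"
        using G by (intro continuous_intros) (auto simp: continuous_on_eq_continuous_at)
    qed
  qed
  define \<omega> where "\<omega> u = exp (- G u)" for u
  \<comment> \<open>Continuity of G and \<open>G 0 = 0\<close> single out \<open>- G\<close> as the
    logarithm, so the powers of \<omega> are exactly the functions in \<open>powers\<close>.\<close>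
  have "is_cont_log \<omega> (\<lambda>u. - G u)"
    unfolding is_cont_log_def \<omega>_def using G G0 by (auto intro!: continuous_intros)
  then have log: "char_log \<omega> = (\<lambda>u. - G u)"
    by (rule char_log_eqI)
  have "inf_div_char_fun \<omega>"
    unfolding inf_div_char_fun_def log
    using powers powers[of 1] by (auto simp: \<omega>_def[abs_def])
  moreover have "char L u = laplace_transform Q Z (- char_log \<omega> u)" for u
  proof -
    \<comment> \<open>The factor \<open>f ^ j\<close> tends to 1 and disappears. Since the whole
      sequence of random sums converges to \<open>L\<close>, a subsequence suffices to identify
      \<open>char L\<close>.\<close>
    have "(\<lambda>n. f (r n) u) \<longlonglongrightarrow> 1"
      using LIMSEQ_subseq_LIMSEQ[OF f_lim r] by (simp add: comp_def)
    moreover have "(\<lambda>n. laplace_transform Q Z (g (r n) u)) \<longlonglongrightarrow> laplace_transform Q Z (G u)"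
      by (rule continuous_on_tendsto_compose[OF continuous_on_laplace_transform lim])
        (use Re_G Re_g in auto)
    ultimately have "(\<lambda>n. char (\<Lambda> (r n)) u) \<longlonglongrightarrow> 1 ^ j * laplace_transform Q Z (G u)"
      unfolding \<Lambda>_eq by (intro tendsto_intros)
    moreover have "(\<lambda>n. char (\<Lambda> (r n)) u) \<longlonglongrightarrow> char L u"
      using LIMSEQ_subseq_LIMSEQ[OF levy_continuity1[OF \<Lambda> L conv, of u] r] by (simp add: comp_def)
    ultimately show ?thesis
      using LIMSEQ_unique by (fastforce simp: log)
  qed
  ultimately show ?thesis by blast
qed

end

theorem theorem2:
  fixes Q :: "'z measure" and Z :: "'z \<Rightarrow> real"
    and j k :: nat and \<Theta> :: "real set"
    and M :: "real \<Rightarrow> 'a measure"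
    and X :: "real \<Rightarrow> nat \<Rightarrow> 'a \<Rightarrow> real"
    and N :: "real \<Rightarrow> 'a \<Rightarrow> nat"
    and \<theta> :: "nat \<Rightarrow> real" and kn :: "nat \<Rightarrow> nat"
    and R :: "'u measure" and U :: "'u \<Rightarrow> real"
    and L :: "real measure"
  assumes Z: "prob_space Q" "Z \<in> borel_measurable Q" "AE x in Q. 0 < Z x"
    and k: "1 \<le> k"
    and Theta: "\<Theta> \<subseteq> {0<..}"
    and M: "\<And>t. t \<in> \<Theta> \<Longrightarrow> prob_space (M t)"
    and X_indep: "\<And>t. t \<in> \<Theta> \<Longrightarrow> prob_space.indep_vars (M t) (\<lambda>_. borel) (X t) {1..}"
    and X_ident: "\<And>t i. t \<in> \<Theta> \<Longrightarrow> 1 \<le> i \<Longrightarrow>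
        distr (M t) borel (X t i) = distr (M t) borel (X t 1)"
    and N_meas: "\<And>t. t \<in> \<Theta> \<Longrightarrow> N t \<in> measurable (M t) (count_space UNIV)"
    and N_indep: "\<And>t. t \<in> \<Theta> \<Longrightarrow> prob_space.indep_set (M t)
        {N t -` A \<inter> space (M t) | A. True}
        (sigma_sets (space (M t)) (\<Union>i\<in>{1..}. {X t i -` B \<inter> space (M t) | B. B \<in> sets borel}))"
    and N_pgf: "\<And>t s. t \<in> \<Theta> \<Longrightarrow> 0 < s \<Longrightarrow> s < 1 \<Longrightarrow>
        complex_of_real (prob_gen_fun (M t) (N t) s) =
          complex_of_real (s ^ j) * laplace_transform Q Z (complex_of_real ((1 - s ^ k) / t))"
    and theta: "\<And>n. \<theta> n \<in> \<Theta>" "decseq \<theta>" "\<theta> \<longlonglongrightarrow> 0"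
    and kn: "\<And>n. 1 \<le> kn n"
    and U: "prob_space R" "U \<in> borel_measurable R" "inf_div_char_fun (char (distr R borel U))"
    and conv_U: "weak_conv_m
        (\<lambda>n. distr (M (\<theta> n)) borel (\<lambda>x. \<Sum>i = 1..kn n. X (\<theta> n) i x)) (distr R borel U)"
    and L: "real_distribution L"
    and conv_L: "weak_conv_m
        (\<lambda>n. distr (M (\<theta> n)) borel (\<lambda>x. \<Sum>i = 1..N (\<theta> n) x. X (\<theta> n) i x)) L"
  shows "\<exists>\<omega>. inf_div_char_fun \<omega> \<and>
           (\<forall>u. char L u = laplace_transform Q Z (- char_log \<omega> u))"
proof -
  interpret positive_random_variable Q Z
    using Z by (intro positive_random_variable.intro positive_random_variable_axioms.intro)
  have pos: "0 < \<theta> n" for n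
    using theta(1) Theta by auto
  note sums = prob_space.char_random_sum[OF M[OF theta(1)] X_indep[OF theta(1)] X_ident[OF theta(1)]
      N_meas[OF theta(1)] N_indep[OF theta(1)]]
  have X_dist: "real_distribution (distr (M (\<theta> n)) borel (X (\<theta> n) 1))" for n
  proof (rule prob_space.real_distribution_distr[OF M[OF theta(1)]])
    show "X (\<theta> n) 1 \<in> borel_measurable (M (\<theta> n))"
      using X_indep[OF theta(1), of n] 
      by (simp add: prob_space.indep_vars_def[OF M[OF theta(1)]])
  qed
  show ?thesis
  proof (rule limit_is_mixture[OF X_dist _ pos theta(3) k _ _ L conv_L])
    \<comment> \<open>The witness is the law of the partial sum with m terms.\<close>
    show "char_fun (\<lambda>u. char (distr (M (\<theta> n)) borel (X (\<theta> n) 1)) u ^ m)" for n m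
      unfolding char_fun_def fun_eq_iff using sums(2,3)[of n] by blast
    show "real_distribution (distr (M (\<theta> n)) borel (\<lambda>x. \<Sum>i = 1..N (\<theta> n) x. X (\<theta> n) i x))" for n
      by (rule sums(1))
    \<comment> \<open>Conditioning on N gives \<open>E[f ^ N]\<close>; the generating function
      identity is then evaluated at the value f of the characteristic function, a point of the
      closed unit disc.\<close>
    show "char (distr (M (\<theta> n)) borel (\<lambda>x. \<Sum>i = 1..N (\<theta> n) x. X (\<theta> n) i x)) u =
        char (distr (M (\<theta> n)) borel (X (\<theta> n) 1)) u ^ j *
        laplace_transform Q Z ((1 - char (distr (M (\<theta> n)) borel (X (\<theta> n) 1)) u ^ k)
          / complex_of_real (\<theta> n))" for n u
      by (rule trans[OF sums(4) expectation_power_eq[OF M[OF theta(1)] N_meas[OF theta(1)] k pos N_pgf[OF theta(1)]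
          real_distribution.cmod_char_le_1[OF X_dist]]])
  qed
qed

end
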